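(* Let $K$ be an algebraically closed field of characteristic zero and let $f\in K[[x_1,\ldots,x_n]]$. Then $\mu(f)<\infty$ if and only if $\tau(f)<\infty$.
   Context: For $f\in K[[x_1,\ldots,x_n]]$ with formal partial derivatives $f_{x_1},\ldots,f_{x_n}$, the Milnor number is $\mu(f)=\dim_K\big(K[[x_1,\ldots,x_n]]/\langle f_{x_1},\ldots,f_{x_n}\rangle\big)$ and the Tjurina number is $\tau(f)=\dim_K\big(K[[x_1,\ldots,x_n]]/\langle f,f_{x_1},\ldots,f_{x_n}\rangle\big)$, both in $\mathbb{Z}_{\geq 0}\cup\{\infty\}$.
   Formalization: The formal theorem additionally assumes that f has zero constant term (f lies in the maximal ideal); without this the claim fails, e.g. for f = 1, where τ(f) = 0 but μ(f) = ∞. *)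

theory Defs
  imports
    "HOL-Library.Poly_Mapping"
    "HOL-Library.Extended_Nat"
    "HOL-Algebra.QuotRing"
    "Jordan_Normal_Form.VS_Connect"
begin

section \<open>Formal power series in several variables\<close>

text \<open>
  An exponent (monomial) in the variables indexed by \<open>'n\<close> is a finitely supported function
  \<open>'n \<Rightarrow>\<^sub>0 nat\<close>; a formal power series is an arbitrary family of coefficients. For
  \<open>'n :: finite\<close> with \<open>CARD('n) = n\<close> the type \<open>('a, 'n) mfps\<close> is
  \<open>K[[x\<^sub>1, \<dots>, x\<^sub>n]]\<close> with \<open>K = 'a\<close>.
\<close>

typedef ('a, 'n) mfps = "UNIV :: (('n \<Rightarrow>\<^sub>0 nat) \<Rightarrow> 'a) set"
  morphisms mfps_nth Abs_mfps ..

lemma mfps_nth_Abs [simp]: "mfps_nth (Abs_mfps f) = f"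
  by (simp add: Abs_mfps_inverse)

lemma mfps_eqI: "(\<And>m. mfps_nth f m = mfps_nth g m) \<Longrightarrow> f = g"
  by (metis ext mfps_nth_inject)

definition antidiag :: "('n \<Rightarrow>\<^sub>0 nat) \<Rightarrow> (('n \<Rightarrow>\<^sub>0 nat) \<times> ('n \<Rightarrow>\<^sub>0 nat)) set" where
  "antidiag m = {(a, b). a + b = m}"

lemma finite_antidiag [simp]:
  fixes m :: "'n \<Rightarrow>\<^sub>0 nat"
  shows "finite (antidiag m)"
proof -
  let ?S = "{k. Poly_Mapping.lookup m k \<noteq> 0}"
  let ?F = "{f :: 'n \<Rightarrow> nat.
      (\<forall>k. (k \<in> ?S \<longrightarrow> f k \<in> {..Max (range (Poly_Mapping.lookup m))}) \<and>
           (k \<notin> ?S \<longrightarrow> f k = 0))}"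
  have fr: "finite (range (Poly_Mapping.lookup m))"
  proof (rule finite_subset)
    show "range (Poly_Mapping.lookup m) \<subseteq> insert 0 (Poly_Mapping.lookup m ` ?S)" by auto
    show "finite (insert 0 (Poly_Mapping.lookup m ` ?S))" by simp
  qed
  have "finite ?F"
    by (rule finite_set_of_finite_funs) simp_all
  moreover have "Poly_Mapping.lookup a \<in> ?F" if "(a, b) \<in> antidiag m" for a b
  proof -
    have le: "Poly_Mapping.lookup a k \<le> Poly_Mapping.lookup m k" for k
      using that by (auto simp: antidiag_def lookup_add)
    have "Poly_Mapping.lookup a k \<le> Max (range (Poly_Mapping.lookup m))" for k
      using le[of k] Max_ge[OF fr, of "Poly_Mapping.lookup m k"] by simp
    moreover have "Poly_Mapping.lookup a k = 0" if "k \<notin> ?S" for k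
      using le[of k] that by simp
    ultimately show ?thesis by simp
  qed
  hence "Poly_Mapping.lookup ` (fst ` antidiag m) \<subseteq> ?F" by force
  ultimately have "finite (Poly_Mapping.lookup ` (fst ` antidiag m))" by (rule finite_subset[rotated])
  hence "finite (fst ` antidiag m)"
    by (rule finite_imageD) (auto intro!: inj_onI poly_mapping_eqI)
  moreover have "inj_on fst (antidiag m)"
    by (auto simp: antidiag_def inj_on_def)
  ultimately show ?thesis by (rule finite_imageD)
qed

instantiation mfps :: (comm_ring_1, type) comm_ring_1
begin

definition "0 = Abs_mfps (\<lambda>_. 0)"
definition "1 = Abs_mfps (\<lambda>m. if m = 0 then 1 else 0)"
definition "f + g = Abs_mfps (\<lambda>m. mfps_nth f m + mfps_nth g m)"
definition "f - g = Abs_mfps (\<lambda>m. mfps_nth f m - mfps_nth g m)"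
definition "- f = Abs_mfps (\<lambda>m. - mfps_nth f m)"
definition "f * g = Abs_mfps (\<lambda>m. \<Sum>(a, b)\<in>antidiag m. mfps_nth f a * mfps_nth g b)"

instance
proof
  fix f g h :: "('a, 'b) mfps"
  show "f * g * h = f * (g * h)"
  proof (rule mfps_eqI)
    fix m
    have "mfps_nth (f * g * h) m =
        (\<Sum>(a, b)\<in>antidiag m. \<Sum>(c, d)\<in>antidiag a. mfps_nth f c * mfps_nth g d * mfps_nth h b)"
      by (simp add: times_mfps_def sum_distrib_right case_prod_unfold)
    also have "\<dots> = (\<Sum>(p, q)\<in>Sigma (antidiag m) (antidiag \<circ> fst).
        mfps_nth f (fst q) * mfps_nth g (snd q) * mfps_nth h (snd p))"
      by (simp add: sum.Sigma case_prod_unfold o_def)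
    also have "\<dots> = (\<Sum>(p, q)\<in>Sigma (antidiag m) (antidiag \<circ> snd).
        mfps_nth f (fst p) * (mfps_nth g (fst q) * mfps_nth h (snd q)))"
      by (rule sum.reindex_bij_witness
          [where j = "\<lambda>((a, b), (c, d)). ((c, d + b), (d, b))"
             and i = "\<lambda>((a, b), (c, d)). ((a + c, d), (a, c))"])
        (auto simp: antidiag_def add.assoc mult.assoc)
    also have "\<dots> = mfps_nth (f * (g * h)) m"
      by (simp add: times_mfps_def sum_distrib_left case_prod_unfold sum.Sigma o_def)
    finally show "mfps_nth (f * g * h) m = mfps_nth (f * (g * h)) m" .
  qed
  show "f * g = g * f"
  proof (rule mfps_eqI)
    fix m
    show "mfps_nth (f * g) m = mfps_nth (g * f) m"
      unfolding times_mfps_def mfps_nth_Abs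
      by (rule sum.reindex_bij_witness[where i = prod.swap and j = prod.swap])
        (auto simp: antidiag_def ac_simps)
  qed
  show "1 * f = f"
  proof (rule mfps_eqI)
    fix m
    have "mfps_nth (1 * f) m =
        (\<Sum>p\<in>antidiag m. if p = (0, m) then mfps_nth f m else 0)"
      unfolding times_mfps_def one_mfps_def mfps_nth_Abs
      by (rule sum.cong) (auto simp: antidiag_def split: if_splits)
    also have "\<dots> = mfps_nth f m"
      by (subst sum.delta) (simp_all, simp add: antidiag_def)
    finally show "mfps_nth (1 * f) m = mfps_nth f m" .
  qed
  show "(f + g) * h = f * h + g * h"
    by (rule mfps_eqI)
      (simp add: times_mfps_def plus_mfps_def case_prod_unfold distrib_right sum.distrib)
  show "f + g + h = f + (g + h)" "f + g = g + f" "0 + f = f" "- f + f = 0" "f - g = f + - g"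
    by (rule mfps_eqI;
        simp add: plus_mfps_def zero_mfps_def uminus_mfps_def minus_mfps_def ac_simps)+
  have "mfps_nth (0 :: ('a, 'b) mfps) 0 \<noteq> mfps_nth 1 0"
    by (simp add: zero_mfps_def one_mfps_def)
  thus "(0 :: ('a, 'b) mfps) \<noteq> 1" by metis
qed

end

definition mfps_const :: "'a::zero \<Rightarrow> ('a, 'n) mfps" where
  "mfps_const c = Abs_mfps (\<lambda>m. if m = 0 then c else 0)"

text \<open>The formal partial derivative: \<open>x\<^sup>m\<close> with \<open>m = m' + e\<^sub>i\<close> contributes
  \<open>(m' i + 1) x\<^bsup>m'\<^esup>\<close>.\<close>

definition mfps_pderiv :: "'n \<Rightarrow> ('a::comm_ring_1, 'n) mfps \<Rightarrow> ('a, 'n) mfps" where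
  "mfps_pderiv i f =
     Abs_mfps (\<lambda>m. of_nat (Suc (Poly_Mapping.lookup m i)) * mfps_nth f (m + Poly_Mapping.single i 1))"

section \<open>The quotient by an ideal as a vector space over the coefficient field\<close>

text \<open>The record \<open>class_ring Quot I\<close> of \<open>HOL-Algebra\<close>, together with the scalar
  multiplication induced by the constants, \<open>K \<rightarrow> K[[x]] \<rightarrow> K[[x]]/I\<close>.\<close>

definition mfps_quot ::
    "('a::comm_ring_1, 'n) mfps set \<Rightarrow> ('a, ('a, 'n) mfps set) module" where
  "mfps_quot I =
     (let R = (class_ring :: ('a, 'n) mfps ring) in
      \<lparr>carrier = carrier (R Quot I),
       mult = mult (R Quot I),
       one = one (R Quot I),
       zero = zero (R Quot I),
       add = add (R Quot I),
       smult = (\<lambda>c X. (I +>\<^bsub>R\<^esub> mfps_const c) \<otimes>\<^bsub>R Quot I\<^esub> X)\<rparr>)"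

lemma mfps_const_ring_hom:
  "mfps_const (a + b) = mfps_const a + (mfps_const b :: ('a::comm_ring_1, 'n) mfps)"
  "mfps_const (a * b) = mfps_const a * (mfps_const b :: ('a::comm_ring_1, 'n) mfps)"
  "mfps_const 1 = (1 :: ('a::comm_ring_1, 'n) mfps)"
proof -
  show "mfps_const (a + b) = mfps_const a + (mfps_const b :: ('a, 'n) mfps)"
    by (rule mfps_eqI) (simp add: mfps_const_def plus_mfps_def)
  show "mfps_const 1 = (1 :: ('a, 'n) mfps)"
    by (simp add: mfps_const_def one_mfps_def)
  show "mfps_const (a * b) = mfps_const a * (mfps_const b :: ('a, 'n) mfps)"
  proof (rule mfps_eqI)
    fix m :: "'n \<Rightarrow>\<^sub>0 nat"
    have "mfps_nth (mfps_const a * mfps_const b) m =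
        (\<Sum>p\<in>antidiag m. if p = (0, 0) then a * b else 0)"
      unfolding times_mfps_def mfps_const_def mfps_nth_Abs by (rule sum.cong) (auto split: if_splits)
    also have "\<dots> = (if (0, 0) \<in> antidiag m then a * b else 0)" by simp
    finally show "mfps_nth (mfps_const (a * b)) m = mfps_nth (mfps_const a * mfps_const b) m"
      by (auto simp: mfps_const_def antidiag_def)
  qed
qed

lemma vectorspace_mfps_quot:
  fixes I :: "('a::field, 'n) mfps set"
  assumes "ideal I class_ring"
  shows "vectorspace class_ring (mfps_quot I)"
proof -
  interpret I: ideal I class_ring by fact
  let ?R = "class_ring :: ('a, 'n) mfps ring"
  let ?Q = "?R Quot I"
  let ?h = "\<lambda>c :: 'a. I +>\<^bsub>?R\<^esub> mfps_const c"
  interpret Q: cring ?Q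
    by (rule I.quotient_is_cring) (rule class_cring.cring_axioms)
  have hom: "(+>\<^bsub>?R\<^esub>) I \<in> Ring.ring_hom ?R ?Q" by (rule I.rcos_ring_hom)
  have h: "?h c \<in> carrier ?Q" "?h (c + d) = ?h c \<oplus>\<^bsub>?Q\<^esub> ?h d"
    "?h (c * d) = ?h c \<otimes>\<^bsub>?Q\<^esub> ?h d" "?h 1 = \<one>\<^bsub>?Q\<^esub>" for c d
    using ring_hom_closed[OF hom, of "mfps_const c"]
      ring_hom_add[OF hom, of "mfps_const c" "mfps_const d"]
      ring_hom_mult[OF hom, of "mfps_const c" "mfps_const d"] ring_hom_one[OF hom]
    by (simp_all add: mfps_const_ring_hom)
  have ag: "abelian_group (mfps_quot I)"
    by (rule abelian_groupI)
      (auto simp: mfps_quot_def Let_def Q.a_ac intro: Q.l_neg bexI[of _ "\<ominus>\<^bsub>?Q\<^esub> _"])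
  have "module class_ring (mfps_quot I)"
    by (rule moduleI[OF class_cring.cring_axioms ag])
      (auto simp: mfps_quot_def Let_def h Q.l_distr Q.r_distr Q.m_assoc)
  thus ?thesis
    unfolding vectorspace_def using class_field by auto
qed

text \<open>The library's \<open>vectorspace.dim\<close> is only meaningful for finite-dimensional spaces.\<close>

definition vs_edim :: "('a, 'k) ring_scheme \<Rightarrow> ('a, 'b, 'm) module_scheme \<Rightarrow> enat" where
  "vs_edim K V = (if vectorspace.fin_dim K V then enat (vectorspace.dim K V) else \<infinity>)"

section \<open>Milnor and Tjurina number\<close>

text \<open>Units need care: for \<open>f = 1\<close> the Tjurina algebra is the zero ring, so the Tjurina number
  is \<open>0\<close>, whereas the ideal of partial derivatives is zero and the Milnor number is \<open>\<infinity>\<close>.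
  Statements comparing the two numbers therefore assume \<open>mfps_nth f 0 = 0\<close>, i.e. that \<open>f\<close> lies
  in the maximal ideal.\<close>

definition milnor_number :: "('a::field, 'n::finite) mfps \<Rightarrow> enat" where
  "milnor_number f =
     vs_edim (class_ring :: 'a ring)
       (mfps_quot (Idl\<^bsub>class_ring\<^esub> (range (\<lambda>i. mfps_pderiv i f))))"

definition tjurina_number :: "('a::field, 'n::finite) mfps \<Rightarrow> enat" where
  "tjurina_number f =
     vs_edim (class_ring :: 'a ring)
       (mfps_quot (Idl\<^bsub>class_ring\<^esub> (insert f (range (\<lambda>i. mfps_pderiv i f)))))"

end

theory Submission
  imports Defs "HOL-Computational_Algebra.Formal_Power_Series"
begin

text \<open>
  Only the implication from \<open>\<tau>(f) < \<infinity>\<close> to \<open>\<mu>(f) < \<infinity>\<close> needs an argument. Let \<open>J\<close> be the ideal of the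
  partial derivatives in \<open>R = K[[x]]\<close>. If some power of \<open>f\<close> lies in \<open>J\<close>, then
  \<open>R/J\<close> is finite-dimensional together with \<open>R/(J + fR)\<close>. Otherwise let \<open>I\<close> be the ideal of all
  \<open>g\<close> with \<open>f\<^sup>k g \<in> J\<close> for some \<open>k\<close>, so that \<open>f\<close> is a nonzerodivisor modulo \<open>I\<close>. A basis \<open>B \<noteq> {}\<close> of
  \<open>R/(I + fR)\<close> then represents each \<open>g \<in> R\<close> by a matrix \<open>\<rho>(g)\<close> over \<open>K[[t]]\<close>, with \<open>\<rho>(f) = t\<close> and
  \<open>\<rho>(I) = 0\<close>. By cyclicity of the trace, \<open>tr(\<rho>(h) \<rho>(g)')\<close> satisfies the
  Leibniz rule in \<open>g\<close>, and a continuity argument yields the chain rule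
  \<open>tr \<rho>(f)' = \<Sum>\<^sub>i tr(\<rho>(f\<^sub>i) \<rho>(x\<^sub>i)')\<close>, where \<open>f\<^sub>i\<close> is the \<open>i\<close>-th partial derivative.
  The right-hand side vanishes because \<open>f\<^sub>i \<in> I\<close>, while the left-hand side is the size of \<open>B\<close>; this is a
  contradiction in characteristic zero.
\<close>

section \<open>Coordinates along a nonzerodivisor\<close>

text \<open>Each value of \<open>D\<close> is divisible by \<open>fps_X\<close> with quotient again
  a value of \<open>D\<close>, hence by all powers of \<open>fps_X\<close>. Identities for
  \<open>coord\<close> follow by taking for \<open>D\<close> the difference of both sides.\<close>

lemma fps_eq_0_if_shift_closed:
  fixes D :: "'g \<Rightarrow> 'a::comm_ring_1 fps"
  assumes "\<And>g. \<exists>g'. D g = fps_X * D g'"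
  shows "D g = 0"
proof -
  have "fps_nth (D g) n = 0" for n
  proof (induction n arbitrary: g)
    case 0
    obtain g' where "D g = fps_X * D g'" using assms by blast
    then show ?case by simp
  next
    case (Suc n)
    obtain g' where "D g = fps_X * D g'" using assms by blast
    then show ?case using Suc by simp
  qed
  then show ?thesis by (simp add: fps_eq_iff)
qed

lemma fps_eq_0_if_all_power_dvd:
  fixes p :: "'a::comm_ring_1 fps"
  assumes "\<And>q. fps_X ^ q dvd p"
  shows "p = 0"
proof -
  have "fps_nth p n = 0" for n
  proof -
    obtain r where "p = fps_X ^ Suc n * r" using assms by (meson dvdE)
    then show ?thesis by (simp only: fps_X_power_mult_nth) simp
  qed
  then show ?thesis by (simp add: fps_eq_iff)
qed

text \<open>\<open>B\<close> represents a K-basis of R/(I + tR), and t cancels modulo I; so R/I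
  resembles, up to completion, a free K[[t]]-module on \<open>B\<close>.\<close>

locale adic_basis =
  fixes emb :: "'a::field \<Rightarrow> 'r::comm_ring_1" and I :: "'r set" and t :: 'r and B :: "'r set"
  assumes emb_add: "emb (c + d) = emb c + emb d"
    and emb_mult: "emb (c * d) = emb c * emb d"
    and emb_one: "emb 1 = 1"
    and zero_in: "0 \<in> I"
    and add_in: "x \<in> I \<Longrightarrow> y \<in> I \<Longrightarrow> x + y \<in> I"
    and mult_in: "x \<in> I \<Longrightarrow> r * x \<in> I"
    and nonzerodivisor: "t * g \<in> I \<Longrightarrow> g \<in> I"
    and finite_B: "finite B"
    and spanning: "\<exists>c u. g - ((\<Sum>b\<in>B. emb (c b) * b) + t * u) \<in> I"
    and independent: "\<And>c u b. (\<Sum>b\<in>B. emb (c b) * b) + t * u \<in> I \<Longrightarrow> b \<in> B \<Longrightarrow> c b = 0"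
begin

lemma uminus_in: "x \<in> I \<Longrightarrow> - x \<in> I"
  using mult_in[of x "-1"] by simp

lemma diff_in: "x \<in> I \<Longrightarrow> y \<in> I \<Longrightarrow> x - y \<in> I"
  using add_in[of x "- y"] uminus_in by simp

lemma emb_zero: "emb 0 = 0"
  using emb_add[of 0 0] by simp

lemma emb_diff: "emb (c - d) = emb c - emb d"
  using emb_add[of "c - d" d] by simp

text \<open>Subtract the two expansions: independence kills the coefficient differences, and t
  cancels from the remaining \<open>t * (u - v)\<close>.\<close>

lemma expansion_unique:
  assumes "g - ((\<Sum>b\<in>B. emb (c b) * b) + t * u) \<in> I"
    and "h - ((\<Sum>b\<in>B. emb (d b) * b) + t * v) \<in> I"
    and "g - h \<in> I"
  shows "\<And>b. b \<in> B \<Longrightarrow> c b = d b" and "u - v \<in> I"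
proof -
  have eq: "(\<Sum>b\<in>B. emb (c b - d b) * b) + t * (u - v) =
     (g - h) - (g - ((\<Sum>b\<in>B. emb (c b) * b) + t * u)) + (h - ((\<Sum>b\<in>B. emb (d b) * b) + t * v))"
    by (simp add: emb_diff sum_subtractf algebra_simps)
  have mem: "(\<Sum>b\<in>B. emb (c b - d b) * b) + t * (u - v) \<in> I"
    unfolding eq by (rule add_in[OF diff_in[OF assms(3,1)] assms(2)])
  show c: "c b = d b" if "b \<in> B" for b
    using independent[OF mem that] by simp
  have "t * (u - v) \<in> I"
    using mem by (simp add: c emb_zero)
  then show "u - v \<in> I" by (rule nonzerodivisor)
qed

text \<open>One digit of a t-adic expansion together with the remainder. By
  \<open>expansion_unique\<close> the choice affects neither the coefficients on \<open>B\<close>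
  nor the remainder modulo \<open>I\<close>.\<close>

definition expand :: "'r \<Rightarrow> ('r \<Rightarrow> 'a) \<times> 'r" where
  "expand g = (SOME p. g - ((\<Sum>b\<in>B. emb (fst p b) * b) + t * snd p) \<in> I)"

lemma expand: "g - ((\<Sum>b\<in>B. emb (fst (expand g) b) * b) + t * snd (expand g)) \<in> I"
  unfolding expand_def by (rule someI_ex) (use spanning[of g] in auto)

text \<open>Iterating \<open>expand\<close> writes \<open>g\<close> as \<open>\<Sum>\<^sub>b coord b g (t) b\<close>, modulo \<open>I\<close> and all powers of \<open>t\<close>; no
  completeness is needed, since only the coefficients are used.\<close>

definition coord :: "'r \<Rightarrow> 'r \<Rightarrow> 'a fps" where
  "coord b g = Abs_fps (\<lambda>n. fst (expand (((snd \<circ> expand) ^^ n) g)) b)"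

lemma coord_unfold:
  "coord b g = fps_const (fst (expand g) b) + fps_X * coord b (snd (expand g))"
  unfolding fps_eq_iff
proof
  fix n
  show "fps_nth (coord b g) n = fps_nth (fps_const (fst (expand g) b) + fps_X * coord b (snd (expand g))) n"
    \<comment> \<open>Peeling off the first iteration instead of the last exposes the shift by
      \<open>fps_X\<close>.\<close>
    by (cases n) (simp_all add: coord_def funpow_Suc_right del: funpow.simps(2))
qed

text \<open>Congruent elements have congruent remainders, so the coefficients agree one after
  another.\<close>

lemma coord_cong:
  assumes "b \<in> B" "g - h \<in> I"
  shows "coord b g = coord b h"
proof -
  have "fps_nth (coord b g) n = fps_nth (coord b h) n" for n
    using assms(2)
  proof (induction n arbitrary: g h)
    case 0
    then show ?case
      using expansion_unique(1)[OF expand expand 0 assms(1)] by (simp add: coord_def)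
  next
    case (Suc n)
    have "snd (expand g) - snd (expand h) \<in> I"
      by (rule expansion_unique(2)[OF expand expand Suc.prems])
    from Suc.IH[OF this] show ?case
      by (simp add: coord_unfold[of b g] coord_unfold[of b h])
  qed
  then show ?thesis by (simp add: fps_eq_iff)
qed

text \<open>Frees the computation of \<open>coord\<close> from the choice made in
  \<open>expand\<close>: any expansion modulo \<open>I\<close> will do.\<close>

lemma coord_eqI:
  assumes "b \<in> B" "g - ((\<Sum>b\<in>B. emb (c b) * b) + t * u) \<in> I"
  shows "coord b g = fps_const (c b) + fps_X * coord b u"
proof -
  have "g - g \<in> I" by (simp add: zero_in)
  from expansion_unique[OF expand assms(2) this]
  have "fst (expand g) b = c b" "snd (expand g) - u \<in> I" using assms(1) by auto
  then show ?thesis using coord_unfold[of b g] coord_cong[OF assms(1)] by metis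
qed

lemma coord_zero: "b \<in> B \<Longrightarrow> coord b 0 = 0"
  \<comment> \<open>Zero has an expansion with remainder zero, so \<open>coord b 0\<close> is
    \<open>fps_X\<close> times itself.\<close>
  by (rule fps_eq_0_if_shift_closed[where D = "\<lambda>_. coord b 0"])
    (use coord_eqI[of b 0 "\<lambda>_. 0" 0] in \<open>simp add: emb_zero zero_in\<close>)

lemma coord_in: "b \<in> B \<Longrightarrow> g \<in> I \<Longrightarrow> coord b g = 0"
  using coord_cong[of b g 0] coord_zero by simp

lemma coord_mult_t: "b \<in> B \<Longrightarrow> coord b (t * g) = fps_X * coord b g"
  using coord_eqI[of b "t * g" "\<lambda>_. 0" g] by (simp add: emb_zero zero_in)

lemma coord_basis:
  assumes "b \<in> B" "b' \<in> B"
  shows "coord b b' = (if b = b' then 1 else 0)"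
proof -
  have "(\<Sum>x\<in>B. emb (if x = b' then 1 else 0) * x) = (\<Sum>x\<in>B. if x = b' then b' else 0)"
    by (rule sum.cong) (auto simp: emb_one emb_zero)
  then have "coord b b' = fps_const (if b = b' then 1 else 0) + fps_X * coord b 0"
    using assms finite_B by (intro coord_eqI) (simp_all add: zero_in)
  then show ?thesis by (simp add: coord_zero assms)
qed

lemma coord_add:
  assumes b: "b \<in> B"
  shows "coord b (g + h) = coord b g + coord b h"
proof -
  \<comment> \<open>Defect of additivity. It lives on pairs because passing to remainders changes
    both arguments.\<close>
  define D where "D = (\<lambda>(g, h). coord b (g + h) - (coord b g + coord b h))"
  have "\<exists>p'. D p = fps_X * D p'" for p
  proof -
    obtain g h where p: "p = (g, h)" by (cases p)
    let ?c = "\<lambda>g. fst (expand g)" and ?u = "\<lambda>g. snd (expand g)"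
    have eq: "g + h - ((\<Sum>b\<in>B. emb (?c g b + ?c h b) * b) + t * (?u g + ?u h)) =
        (g - ((\<Sum>b\<in>B. emb (?c g b) * b) + t * ?u g)) + (h - ((\<Sum>b\<in>B. emb (?c h b) * b) + t * ?u h))"
      by (simp add: emb_add sum.distrib algebra_simps)
    have "g + h - ((\<Sum>b\<in>B. emb (?c g b + ?c h b) * b) + t * (?u g + ?u h)) \<in> I"
      unfolding eq by (intro add_in expand)
    from coord_eqI[OF b this]
    have "D p = fps_X * D (?u g, ?u h)"
      using coord_unfold[of b g] coord_unfold[of b h]
      by (simp add: D_def p algebra_simps flip: fps_const_add)
    then show ?thesis by blast
  qed
  then have "D (g, h) = 0" by (rule fps_eq_0_if_shift_closed)
  then show ?thesis by (simp add: D_def)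
qed

lemma coord_sum: "b \<in> B \<Longrightarrow> coord b (\<Sum>x\<in>A. g x) = (\<Sum>x\<in>A. coord b (g x))"
  by (induction A rule: infinite_finite_induct) (simp_all add: coord_zero coord_add)

lemma coord_scale:
  assumes b: "b \<in> B"
  shows "coord b (emb k * g) = fps_const k * coord b g"
proof -
  define D where "D = (\<lambda>g. coord b (emb k * g) - fps_const k * coord b g)"
  have "\<exists>g'. D g = fps_X * D g'" for g
  proof -
    let ?c = "fst (expand g)" and ?u = "snd (expand g)"
    have "emb k * g - ((\<Sum>b\<in>B. emb (k * ?c b) * b) + t * (emb k * ?u)) \<in> I"
      using mult_in[OF expand[of g], of "emb k"]
      by (simp add: emb_mult algebra_simps sum_distrib_left)
    from coord_eqI[OF b this]
    have "D g = fps_X * D ?u"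
      using coord_unfold[of b g] by (simp add: D_def algebra_simps)
    then show ?thesis by blast
  qed
  then have "D g = 0" by (rule fps_eq_0_if_shift_closed)
  then show ?thesis by (simp add: D_def)
qed

text \<open>By K[[t]]-linearity, multiplication by \<open>g\<close> is determined by its values on
  \<open>B\<close>; the defect at \<open>h\<close> is \<open>fps_X\<close> times the defect at the
  remainder of \<open>h\<close>.\<close>

lemma coord_mult:
  assumes b: "b \<in> B"
  shows "coord b (g * h) = (\<Sum>b'\<in>B. coord b (g * b') * coord b' h)"
proof -
  define D where "D = (\<lambda>h. coord b (g * h) - (\<Sum>b'\<in>B. coord b (g * b') * coord b' h))"
  have "\<exists>h'. D h = fps_X * D h'" for h
  proof -
    let ?c = "fst (expand h)" and ?u = "snd (expand h)"
    let ?h = "(\<Sum>b\<in>B. emb (?c b) * b) + t * ?u"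
    have "g * h - g * ?h \<in> I"
      using mult_in[OF expand[of h], of g] by (simp add: algebra_simps)
    then have "coord b (g * h) = coord b (g * ?h)" by (rule coord_cong[OF b])
    also have "g * ?h = (\<Sum>b'\<in>B. emb (?c b') * (g * b')) + t * (g * ?u)"
      by (simp add: algebra_simps sum_distrib_left)
    also have "coord b \<dots> = (\<Sum>b'\<in>B. fps_const (?c b') * coord b (g * b')) + fps_X * coord b (g * ?u)"
      by (simp add: b coord_add coord_sum coord_scale coord_mult_t)
    finally have 1: "coord b (g * h) =
      (\<Sum>b'\<in>B. fps_const (?c b') * coord b (g * b')) + fps_X * coord b (g * ?u)" .
    have 2: "(\<Sum>b'\<in>B. coord b (g * b') * coord b' h) =
      (\<Sum>b'\<in>B. fps_const (?c b') * coord b (g * b')) + fps_X * (\<Sum>b'\<in>B. coord b (g * b') * coord b' ?u)"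
      by (subst coord_unfold) (simp add: algebra_simps sum.distrib sum_distrib_left)
    have "D h = fps_X * D ?u"
      unfolding D_def 1 2 by (simp add: algebra_simps)
    then show ?thesis by blast
  qed
  then have "D h = 0" by (rule fps_eq_0_if_shift_closed)
  then show ?thesis by (simp add: D_def)
qed

section \<open>Regular representation over K[[t]] and its trace form\<close>

definition mult_matrix :: "'r \<Rightarrow> 'r \<Rightarrow> 'r \<Rightarrow> 'a fps" where
  "mult_matrix g b b' = coord b (g * b')"

lemma mult_matrix_mult:
  "b \<in> B \<Longrightarrow> mult_matrix (g * h) b b' = (\<Sum>b''\<in>B. mult_matrix g b b'' * mult_matrix h b'' b')"
  using coord_mult[of b g "h * b'"] by (simp add: mult_matrix_def mult.assoc)

lemma mult_matrix_add:
  "b \<in> B \<Longrightarrow> mult_matrix (g + h) b b' = mult_matrix g b b' + mult_matrix h b b'"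
  by (simp add: mult_matrix_def distrib_right coord_add)

lemma mult_matrix_in: "b \<in> B \<Longrightarrow> g \<in> I \<Longrightarrow> mult_matrix g b b' = 0"
  using mult_in[of g b'] by (simp add: mult_matrix_def coord_in mult.commute)

lemma mult_matrix_mult_t: "b \<in> B \<Longrightarrow> mult_matrix (t * g) b b' = fps_X * mult_matrix g b b'"
  by (simp add: mult_matrix_def coord_mult_t mult.assoc)

lemma mult_matrix_emb:
  "b \<in> B \<Longrightarrow> b' \<in> B \<Longrightarrow> mult_matrix (emb c) b b' = (if b = b' then fps_const c else 0)"
  by (simp add: mult_matrix_def coord_scale coord_basis)

text \<open>This is tr(\<rho>(h) \<rho>(g)') with \<rho> = \<open>mult_matrix\<close> and the
  derivative taken in t.\<close>

definition trace_form :: "'r \<Rightarrow> 'r \<Rightarrow> 'a fps" where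
  "trace_form h g = (\<Sum>b\<in>B. \<Sum>b'\<in>B. mult_matrix h b b' * fps_deriv (mult_matrix g b' b))"

lemma trace_form_add_left: "trace_form (h + k) g = trace_form h g + trace_form k g"
  by (simp add: trace_form_def mult_matrix_add distrib_right sum.distrib)

lemma trace_form_add_right: "trace_form h (g + k) = trace_form h g + trace_form h k"
  by (simp add: trace_form_def mult_matrix_add distrib_left sum.distrib)

lemma trace_form_in: "h \<in> I \<Longrightarrow> trace_form h g = 0"
  by (simp add: trace_form_def mult_matrix_in)

lemma trace_form_mult_t: "trace_form (t * h) g = fps_X * trace_form h g"
  by (simp add: trace_form_def mult_matrix_mult_t mult.assoc sum_distrib_left)

lemma trace_form_emb: "trace_form h (emb c) = 0"
  by (auto simp: trace_form_def mult_matrix_emb intro!: sum.neutral)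

text \<open>\<rho>(t) is \<open>fps_X\<close> times the identity matrix, so its derivative is the
  identity, whose trace counts \<open>B\<close>.\<close>

lemma trace_form_one_t: "trace_form 1 t = of_nat (card B)"
proof -
  have "trace_form 1 t = (\<Sum>b\<in>B. \<Sum>b'\<in>B. if b = b' then 1 else 0)"
    unfolding trace_form_def
  proof (intro sum.cong refl)
    fix b b' assume "b \<in> B" "b' \<in> B"
    then show "mult_matrix 1 b b' * fps_deriv (mult_matrix t b' b) = (if b = b' then 1 else 0)"
      using mult_matrix_mult_t[of b' 1 b] mult_matrix_emb[of _ _ 1] by (simp add: emb_one)
  qed
  also have "\<dots> = of_nat (card B)" using finite_B by simp
  finally show ?thesis .
qed

text \<open>The Leibniz rule survives although a matrix and its derivative need not commute, because the
  trace is invariant under cyclic permutations.\<close>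

lemma trace_form_mult_right: "trace_form h (g * k) = trace_form (h * k) g + trace_form (h * g) k"
proof -
  let ?m = mult_matrix and ?d = fps_deriv
  have "trace_form h (g * k) =
      (\<Sum>b\<in>B. \<Sum>b'\<in>B. \<Sum>b''\<in>B. ?m h b b' * (?d (?m g b' b'') * ?m k b'' b)) +
      (\<Sum>b\<in>B. \<Sum>b'\<in>B. \<Sum>b''\<in>B. ?m h b b' * (?m g b' b'' * ?d (?m k b'' b)))"
    by (simp add: trace_form_def mult_matrix_mult fps_deriv_sum sum_distrib_left sum.distrib algebra_simps)
  also have "(\<Sum>b\<in>B. \<Sum>b'\<in>B. \<Sum>b''\<in>B. ?m h b b' * (?m g b' b'' * ?d (?m k b'' b))) = trace_form (h * g) k"
  proof -
    have "trace_form (h * g) k =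
        (\<Sum>b\<in>B. \<Sum>b''\<in>B. \<Sum>b'\<in>B. ?m h b b' * (?m g b' b'' * ?d (?m k b'' b)))"
      by (simp add: trace_form_def mult_matrix_mult sum_distrib_right mult.assoc)
    also have "\<dots> = (\<Sum>b\<in>B. \<Sum>b'\<in>B. \<Sum>b''\<in>B. ?m h b b' * (?m g b' b'' * ?d (?m k b'' b)))"
      by (rule sum.cong[OF refl], rule sum.swap)
    finally show ?thesis by simp
  qed
  also have "(\<Sum>b\<in>B. \<Sum>b'\<in>B. \<Sum>b''\<in>B. ?m h b b' * (?d (?m g b' b'') * ?m k b'' b)) = trace_form (h * k) g"
  proof -
    \<comment> \<open>Commutativity of the ring brings \<open>k\<close> to the front: tr(\<rho>(k)
      \<rho>(h) \<rho>(g)') is a cyclic rotation of the required trace. The swaps below only reorder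
      the sums.\<close>
    have "trace_form (h * k) g = trace_form (k * h) g" by (simp add: mult.commute)
    also have "\<dots> = (\<Sum>b''\<in>B. \<Sum>b'\<in>B. \<Sum>b\<in>B. ?m h b b' * (?d (?m g b' b'') * ?m k b'' b))"
      by (simp add: trace_form_def mult_matrix_mult sum_distrib_right) (simp add: ac_simps)
    also have "\<dots> = (\<Sum>b'\<in>B. \<Sum>b''\<in>B. \<Sum>b\<in>B. ?m h b b' * (?d (?m g b' b'') * ?m k b'' b))"
      by (rule sum.swap)
    also have "\<dots> = (\<Sum>b'\<in>B. \<Sum>b\<in>B. \<Sum>b''\<in>B. ?m h b b' * (?d (?m g b' b'') * ?m k b'' b))"
      by (rule sum.cong[OF refl], rule sum.swap)
    also have "\<dots> = (\<Sum>b\<in>B. \<Sum>b'\<in>B. \<Sum>b''\<in>B. ?m h b b' * (?d (?m g b' b'') * ?m k b'' b))"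
      by (rule sum.swap)
    finally show ?thesis by simp
  qed
  finally show ?thesis .
qed

end

section \<open>Multivariate power series\<close>

lemma mfps_nth_simps [simp]:
  "mfps_nth 0 m = 0" "mfps_nth (f + g) m = mfps_nth f m + mfps_nth g m"
  "mfps_nth (f - g) m = mfps_nth f m - mfps_nth g m" "mfps_nth (- f) m = - mfps_nth f m"
  "mfps_nth 1 m = (if m = 0 then 1 else 0)" "mfps_nth (mfps_const c) m = (if m = 0 then c else 0)"
  by (simp_all add: zero_mfps_def plus_mfps_def minus_mfps_def uminus_mfps_def one_mfps_def mfps_const_def)

lemma mfps_nth_mult: "mfps_nth (f * g) m = (\<Sum>(a, b)\<in>antidiag m. mfps_nth f a * mfps_nth g b)"
  by (simp add: times_mfps_def)

lemma mfps_nth_sum: "mfps_nth (\<Sum>x\<in>A. g x) m = (\<Sum>x\<in>A. mfps_nth (g x) m)"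
  by (induction A rule: infinite_finite_induct) simp_all

lemma poly_mapping_nat_add_eq_0:
  fixes a b :: "'n \<Rightarrow>\<^sub>0 nat"
  assumes "a + b = 0"
  shows "a = 0"
proof (rule poly_mapping_eqI)
  fix k
  have "Poly_Mapping.lookup a k + Poly_Mapping.lookup b k = 0"
    using arg_cong[OF assms, of "\<lambda>p. Poly_Mapping.lookup p k"] unfolding lookup_add by (simp only: lookup_zero)
  then show "Poly_Mapping.lookup a k = Poly_Mapping.lookup 0 k" by simp
qed

lemma antidiag_0 [simp]: "antidiag (0 :: 'n \<Rightarrow>\<^sub>0 nat) = {(0, 0)}"
proof
  show "antidiag (0 :: 'n \<Rightarrow>\<^sub>0 nat) \<subseteq> {(0, 0)}"
  proof
    fix p :: "('n \<Rightarrow>\<^sub>0 nat) \<times> ('n \<Rightarrow>\<^sub>0 nat)"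
    assume "p \<in> antidiag 0"
    then have sum: "fst p + snd p = 0" by (auto simp: antidiag_def)
    have "fst p = 0" by (rule poly_mapping_nat_add_eq_0[OF sum])
    moreover from this have "snd p = 0" using sum by simp
    ultimately show "p \<in> {(0, 0)}" by (cases p) simp
  qed
qed (simp add: antidiag_def)

lemma mfps_nth_mult_0 [simp]: "mfps_nth (f * g) 0 = mfps_nth f 0 * mfps_nth g 0"
  by (simp add: mfps_nth_mult)

lemma mfps_const_zero [simp]: "mfps_const 0 = (0 :: ('a::comm_ring_1, 'n) mfps)"
  by (rule mfps_eqI) simp

section \<open>Total degree and invertible series\<close>

definition mdeg :: "('n::finite \<Rightarrow>\<^sub>0 nat) \<Rightarrow> nat" where
  "mdeg m = (\<Sum>i\<in>UNIV. Poly_Mapping.lookup m i)"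

lemma mdeg_add: "mdeg (a + b) = mdeg a + mdeg b"
  by (simp add: mdeg_def lookup_add sum.distrib)

lemma mdeg_single [simp]: "mdeg (Poly_Mapping.single i k) = k"
  by (simp add: mdeg_def lookup_single when_def)

lemma single_Suc_neq_0 [simp]: "Poly_Mapping.single i (Suc k) \<noteq> 0"
  by (metis lookup_single_eq lookup_zero nat.distinct(1))

lemma mdeg_eq_0_iff: "mdeg m = 0 \<longleftrightarrow> m = 0"
  by (auto simp: mdeg_def poly_mapping_eq_iff fun_eq_iff)

text \<open>Factors of a monomial have no larger degree. This lets a partial sum replace an infinite
  series inside a product.\<close>

lemma mfps_nth_mult_cong:
  fixes u v :: "('a::comm_ring_1, 'n::finite) mfps"
  assumes "\<And>c. mdeg c \<le> mdeg m \<Longrightarrow> mfps_nth u c = mfps_nth v c"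
  shows "mfps_nth (g * u) m = mfps_nth (g * v) m"
  unfolding mfps_nth_mult by (rule sum.cong) (auto simp: antidiag_def mdeg_add assms)

lemma mfps_nth_power_eq_0:
  fixes h :: "('a::comm_ring_1, 'n::finite) mfps"
  assumes "mfps_nth h 0 = 0" "mdeg m < k"
  shows "mfps_nth (h ^ k) m = 0"
  using assms(2)
proof (induction k arbitrary: m)
  case (Suc k)
  have "mfps_nth h a * mfps_nth (h ^ k) b = 0" if "a + b = m" for a b
  proof (cases "a = 0")
    case False
    then have "mdeg b < k" using Suc.prems that mdeg_eq_0_iff[of a] mdeg_add[of a b] by auto
    then show ?thesis by (simp add: Suc.IH)
  qed (simp add: assms)
  then show ?case by (auto simp: mfps_nth_mult antidiag_def intro!: sum.neutral)
qed simp

lemma mfps_one_minus_invertible: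
  fixes h :: "('a::comm_ring_1, 'n::finite) mfps"
  assumes h: "mfps_nth h 0 = 0"
  shows "\<exists>w. (1 - h) * w = 1"
proof
  define W where "W = (\<lambda>N. \<Sum>k<N. h ^ k)"
  \<comment> \<open>Geometric series, taken coefficientwise: \<open>h ^ k\<close> has no terms below
    degree k, so the \<open>Suc (mdeg m)\<close> powers from 0 to \<open>mdeg m\<close>
    suffice.\<close>
  define w where "w = Abs_mfps (\<lambda>m. mfps_nth (W (Suc (mdeg m))) m)"
  have W: "mfps_nth (W N) c = mfps_nth w c" if "mdeg c < N" for N c
  proof -
    have "mfps_nth (W N) c = (\<Sum>k<N. mfps_nth (h ^ k) c)" by (simp add: W_def mfps_nth_sum)
    also have "\<dots> = (\<Sum>k<Suc (mdeg c). mfps_nth (h ^ k) c)"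
      by (rule sum.mono_neutral_right) (use that mfps_nth_power_eq_0[OF h, of c] in auto)
    finally show ?thesis by (simp add: w_def W_def mfps_nth_sum)
  qed
  show "(1 - h) * w = 1"
  proof (rule mfps_eqI)
    fix m
    have "mfps_nth ((1 - h) * w) m = mfps_nth ((1 - h) * W (Suc (mdeg m))) m"
      by (rule mfps_nth_mult_cong) (simp add: W)
    also have "(1 - h) * W (Suc (mdeg m)) = 1 - h ^ Suc (mdeg m)"
      unfolding W_def by (rule one_diff_power_eq[symmetric])
    finally show "mfps_nth ((1 - h) * w) m = mfps_nth 1 m"
      using mfps_nth_power_eq_0[OF h, of m "Suc (mdeg m)"] by (simp del: power_Suc)
  qed
qed

lemma mfps_invertible:
  fixes e :: "('a::field, 'n::finite) mfps"
  assumes "mfps_nth e 0 \<noteq> 0"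
  shows "\<exists>w. e * w = 1"
proof -
  define c where "c = mfps_const (inverse (mfps_nth e 0)) * e"
  have "mfps_nth (1 - c) 0 = 0" using assms by (simp add: c_def)
  from mfps_one_minus_invertible[OF this] obtain w where "c * w = 1" by auto
  then have "e * (mfps_const (inverse (mfps_nth e 0)) * w) = 1" by (simp add: c_def ac_simps)
  then show ?thesis by blast
qed

section \<open>Monomials, polynomials and truncation\<close>

definition mfps_monom :: "'a::zero \<Rightarrow> ('n \<Rightarrow>\<^sub>0 nat) \<Rightarrow> ('a, 'n) mfps" where
  "mfps_monom c a = Abs_mfps (\<lambda>m. if m = a then c else 0)"

definition mfps_X :: "'n \<Rightarrow> ('a::zero_neq_one, 'n) mfps" where
  "mfps_X i = mfps_monom 1 (Poly_Mapping.single i 1)"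

lemma mfps_nth_monom [simp]: "mfps_nth (mfps_monom c a) m = (if m = a then c else 0)"
  by (simp add: mfps_monom_def)

lemma mfps_monom_0: "mfps_monom c 0 = mfps_const c"
  by (simp add: mfps_monom_def mfps_const_def)

lemma mfps_nth_X_0 [simp]: "mfps_nth (mfps_X i) 0 = 0"
  by (simp add: mfps_X_def)

lemma mfps_nth_monom_mult:
  fixes f :: "('a::comm_ring_1, 'n) mfps"
  shows "mfps_nth (mfps_monom c a * f) (a + m) = c * mfps_nth f m"
    and "(\<And>m'. m \<noteq> a + m') \<Longrightarrow> mfps_nth (mfps_monom c a * f) m = 0"
proof -
  have "mfps_nth (mfps_monom c a * f) (a + m) = (\<Sum>p\<in>antidiag (a + m). if p = (a, m) then c * mfps_nth f m else 0)"
    unfolding mfps_nth_mult by (rule sum.cong) (auto simp: antidiag_def split: if_splits)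
  also have "\<dots> = c * mfps_nth f m"
    by (subst sum.delta) (simp_all, simp add: antidiag_def)
  finally show "mfps_nth (mfps_monom c a * f) (a + m) = c * mfps_nth f m" .
  show "mfps_nth (mfps_monom c a * f) m = 0" if "\<And>m'. m \<noteq> a + m'"
    unfolding mfps_nth_mult by (rule sum.neutral) (use that in \<open>auto simp: antidiag_def\<close>)
qed

lemma mfps_monom_mult:
  "mfps_monom c a * mfps_monom d b = mfps_monom (c * d :: 'a::comm_ring_1) (a + b)"
proof (rule mfps_eqI)
  fix m
  show "mfps_nth (mfps_monom c a * mfps_monom d b) m = mfps_nth (mfps_monom (c * d) (a + b)) m"
  proof (cases "\<exists>m'. m = a + m'")
    case True
    then show ?thesis by (auto simp: mfps_nth_monom_mult)
  next
    case False
    then show ?thesis using mfps_nth_monom_mult(2)[of m a c "mfps_monom d b"] by auto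
  qed
qed

lemma mfps_X_power: "mfps_X i ^ n = (mfps_monom 1 (Poly_Mapping.single i n) :: ('a::comm_ring_1, 'n) mfps)"
proof (induction n)
  case 0
  then show ?case by (simp add: mfps_monom_0 mfps_const_ring_hom)
next
  case (Suc n)
  then show ?case by (simp add: mfps_X_def mfps_monom_mult flip: single_add)
qed

lemma le_lookup_iff_add:
  fixes m :: "'n \<Rightarrow>\<^sub>0 nat"
  shows "n \<le> Poly_Mapping.lookup m i \<longleftrightarrow> (\<exists>m'. m = Poly_Mapping.single i n + m')"
proof
  assume *: "n \<le> Poly_Mapping.lookup m i"
  have "m = Poly_Mapping.single i n + (m - Poly_Mapping.single i n)"
    by (rule poly_mapping_eqI) (use * in \<open>auto simp: lookup_add lookup_minus lookup_single when_def\<close>)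
  then show "\<exists>m'. m = Poly_Mapping.single i n + m'" by blast
qed (auto simp: lookup_add)

text \<open>Series of finite support are polynomials, which constants and variables generate under
  sums and products. The chain rule is verified on them this way.\<close>

lemma mfps_finite_support_induct [consumes 1, case_names const X add mult]:
  fixes g :: "('a::comm_ring_1, 'n::finite) mfps"
  assumes "finite {m. mfps_nth g m \<noteq> 0}"
    and const: "\<And>c. P (mfps_const c)"
    and X: "\<And>i. P (mfps_X i)"
    and add: "\<And>f g. P f \<Longrightarrow> P g \<Longrightarrow> P (f + g)"
    and mult: "\<And>f g. P f \<Longrightarrow> P g \<Longrightarrow> P (f * g)"
  shows "P g"
proof -
  have monom: "P (mfps_monom c m)" for c m
  proof (induction "mdeg m" arbitrary: m rule: less_induct)
    case less
    show ?case
    proof (cases "m = 0")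
      case True
      then show ?thesis by (simp add: mfps_monom_0 const)
    next
      case False
      then obtain i where "Poly_Mapping.lookup m i \<noteq> 0"
        by (metis lookup_zero poly_mapping_eqI)
      then obtain m' where m': "m = Poly_Mapping.single i 1 + m'"
        using le_lookup_iff_add[of 1 m i] by auto
      have "mdeg m' < mdeg m" unfolding m' mdeg_add by simp
      then have "P (mfps_X i * mfps_monom c m')" by (intro mult X less)
      then show ?thesis by (simp add: m' mfps_X_def mfps_monom_mult)
    qed
  qed
  have sum: "finite A \<Longrightarrow> P (\<Sum>x\<in>A. h x)" if "\<And>x. P (h x)" for h and A :: "('n \<Rightarrow>\<^sub>0 nat) set"
    by (induction A rule: finite_induct) (use const[of 0] that add in auto)
  have "g = (\<Sum>m | mfps_nth g m \<noteq> 0. mfps_monom (mfps_nth g m) m)"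
    by (rule mfps_eqI) (use assms(1) in \<open>simp add: mfps_nth_sum\<close>)
  moreover have "P (\<Sum>m | mfps_nth g m \<noteq> 0. mfps_monom (mfps_nth g m) m)"
    by (rule sum[OF monom assms(1)])
  ultimately show ?thesis by simp
qed

text \<open>The terms are assigned to one variable after another, so infinitely many monomials are
  collected into finitely many cofactors.\<close>

lemma mfps_in_ideal_of_X_powers:
  fixes g :: "('a::comm_ring_1, 'n::finite) mfps"
  assumes "\<And>m. mfps_nth g m \<noteq> 0 \<Longrightarrow> \<exists>i\<in>V. N \<le> Poly_Mapping.lookup m i"
  shows "\<exists>r. g = (\<Sum>i\<in>V. mfps_X i ^ N * r i)"
  using finite[of V] assms
proof (induction V arbitrary: g rule: finite_induct)
  case empty
  then have "g = 0" by (intro mfps_eqI) auto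
  then show ?case by simp
next
  case (insert i V)
  \<comment> \<open>Shifted coefficients form the quotient by \<open>mfps_X i ^ N\<close> of all
    terms divisible by it; \<open>h\<close> retains exactly the other terms.\<close>
  define s where "s = Abs_mfps (\<lambda>m. mfps_nth g (Poly_Mapping.single i N + m))"
  define h where "h = g - mfps_X i ^ N * s"
  have h: "mfps_nth h m = (if N \<le> Poly_Mapping.lookup m i then 0 else mfps_nth g m)" for m
  proof (cases "N \<le> Poly_Mapping.lookup m i")
    case True
    then obtain m' where "m = Poly_Mapping.single i N + m'" unfolding le_lookup_iff_add by blast
    then have "mfps_nth (mfps_X i ^ N * s) m = mfps_nth g m"
      by (simp add: mfps_X_power mfps_nth_monom_mult(1) s_def)
    then show ?thesis using True by (simp add: h_def)
  next
    case False
    then have "m \<noteq> Poly_Mapping.single i N + m'" for m' by (auto simp: lookup_add)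
    then have "mfps_nth (mfps_X i ^ N * s) m = 0"
      unfolding mfps_X_power by (rule mfps_nth_monom_mult(2))
    then show ?thesis using False by (simp add: h_def)
  qed
  have "\<exists>r. h = (\<Sum>i\<in>V. mfps_X i ^ N * r i)"
  proof (rule insert.IH)
    fix m assume "mfps_nth h m \<noteq> 0"
    then have "mfps_nth g m \<noteq> 0" "\<not> N \<le> Poly_Mapping.lookup m i" by (auto simp: h split: if_splits)
    then show "\<exists>i\<in>V. N \<le> Poly_Mapping.lookup m i" using insert.prems by blast
  qed
  then obtain r where r: "h = (\<Sum>i\<in>V. mfps_X i ^ N * r i)" by blast
  have "(\<Sum>j\<in>V. mfps_X j ^ N * (r(i := s)) j) = h"
    unfolding r by (rule sum.cong) (use insert.hyps in auto)
  then have "g = (\<Sum>j\<in>insert i V. mfps_X j ^ N * (r(i := s)) j)"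
    using insert.hyps by (simp add: h_def)
  then show ?case by blast
qed

text \<open>Truncation bounds each exponent separately, not the total degree; every discarded term
  is then divisible by some \<open>mfps_X i ^ N\<close>. The later continuity argument rests on this
  splitting.\<close>

lemma mfps_split_X_powers:
  fixes g :: "('a::comm_ring_1, 'n::finite) mfps"
  obtains p r where "finite {m. mfps_nth p m \<noteq> 0}" "g = p + (\<Sum>i\<in>UNIV. mfps_X i ^ N * r i)"
proof -
  define p where "p = Abs_mfps (\<lambda>m. if \<forall>i. Poly_Mapping.lookup m i < N then mfps_nth g m else 0)"
  have "finite {l :: 'n \<Rightarrow> nat. \<forall>i. l i < N}"
    using finite_set_of_finite_funs[of "UNIV :: 'n set" "{..<N}" 0] by simp
  moreover have "inj (Poly_Mapping.lookup :: ('n \<Rightarrow>\<^sub>0 nat) \<Rightarrow> 'n \<Rightarrow> nat)"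
    by (rule injI) (simp add: lookup_inject)
  ultimately have "finite (Poly_Mapping.lookup -` {l :: 'n \<Rightarrow> nat. \<forall>i. l i < N})"
    by (rule finite_vimageI)
  then have "finite {m. mfps_nth p m \<noteq> 0}"
  proof (rule finite_subset[rotated])
    show "{m. mfps_nth p m \<noteq> 0} \<subseteq> Poly_Mapping.lookup -` {l. \<forall>i. l i < N}"
      unfolding p_def by (auto simp only: mfps_nth_Abs split: if_splits)
  qed
  note fin = this
  have "\<exists>r. g - p = (\<Sum>i\<in>UNIV. mfps_X i ^ N * r i)"
  proof (rule mfps_in_ideal_of_X_powers)
    fix m assume "mfps_nth (g - p) m \<noteq> 0"
    then have "\<not> (\<forall>i. Poly_Mapping.lookup m i < N)" by (cases "\<forall>i. Poly_Mapping.lookup m i < N") (simp_all add: p_def)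
    then show "\<exists>i\<in>UNIV. N \<le> Poly_Mapping.lookup m i" by (simp add: not_less)
  qed
  then obtain r where "g - p = (\<Sum>i\<in>UNIV. mfps_X i ^ N * r i)" ..
  then have "g = p + (\<Sum>i\<in>UNIV. mfps_X i ^ N * r i)" by (simp add: diff_eq_eq add.commute)
  with fin show thesis by (rule that)
qed

section \<open>Formal partial derivatives\<close>

lemma mfps_nth_pderiv [simp]:
  "mfps_nth (mfps_pderiv i f) m =
     of_nat (Suc (Poly_Mapping.lookup m i)) * mfps_nth f (m + Poly_Mapping.single i 1)"
  by (simp add: mfps_pderiv_def)

lemma mfps_pderiv_add: "mfps_pderiv i (f + g) = mfps_pderiv i f + mfps_pderiv i g"
  by (rule mfps_eqI) (simp add: distrib_left)

lemma mfps_pderiv_const [simp]: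
  fixes i :: 'n
  shows "mfps_pderiv i (mfps_const c) = 0"
proof (rule mfps_eqI)
  fix m :: "'n \<Rightarrow>\<^sub>0 nat"
  have "m + Poly_Mapping.single i 1 \<noteq> 0"
    using poly_mapping_nat_add_eq_0[of "Poly_Mapping.single i 1" m] by (auto simp: add.commute)
  then show "mfps_nth (mfps_pderiv i (mfps_const c)) m = mfps_nth 0 m" by simp
qed

lemma mfps_pderiv_X:
  fixes i j :: 'n
  shows "mfps_pderiv i (mfps_X j) = (if i = j then 1 else 0)"
proof (rule mfps_eqI)
  fix m :: "'n \<Rightarrow>\<^sub>0 nat"
  have *: "m = 0 \<and> i = j" if "m + Poly_Mapping.single i 1 = Poly_Mapping.single j 1"
  proof -
    have l: "Poly_Mapping.lookup m k + (1 when i = k) = (1 when j = k)" for k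
      using that by (metis lookup_add lookup_single)
    have "i = j" using l[of i] by (auto simp: when_def split: if_splits)
    moreover from this have "m = 0" using that by simp
    ultimately show ?thesis by simp
  qed
  show "mfps_nth (mfps_pderiv i (mfps_X j)) m = mfps_nth (if i = j then 1 else 0) m"
    using * by (auto simp: mfps_X_def)
qed

text \<open>All coefficients become sums over \<open>antidiag (m + ?e)\<close>, weighted by the i-th
  exponent of \<open>a\<close>, of \<open>b\<close> and of \<open>a + b\<close>; these weights
  add.\<close>

lemma mfps_pderiv_mult:
  fixes f g :: "('a::comm_ring_1, 'n) mfps"
  shows "mfps_pderiv i (f * g) = mfps_pderiv i f * g + f * mfps_pderiv i g"
proof (rule mfps_eqI)
  fix m :: "'n \<Rightarrow>\<^sub>0 nat"
  let ?e = "Poly_Mapping.single i (1::nat)" and ?l = "\<lambda>a. of_nat (Poly_Mapping.lookup a i)"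
  have left: "mfps_nth (mfps_pderiv i f * g) m =
      (\<Sum>(a, b)\<in>antidiag (m + ?e). ?l a * mfps_nth f a * mfps_nth g b)" for f g :: "('a, 'n) mfps"
  proof -
    \<comment> \<open>The image of \<open>?h\<close> misses only pairs in which \<open>a\<close> has
      i-th exponent zero, and these carry weight zero.\<close>
    let ?h = "\<lambda>(a, b). (a + ?e, b)"
    have inj: "inj_on ?h (antidiag m)" by (auto simp: inj_on_def)
    have "(\<Sum>(a, b)\<in>antidiag (m + ?e). ?l a * mfps_nth f a * mfps_nth g b) =
        (\<Sum>(a, b)\<in>?h ` antidiag m. ?l a * mfps_nth f a * mfps_nth g b)"
    proof (rule sum.mono_neutral_right)
      show "finite (antidiag (m + ?e))" by simp
      show "\<forall>p\<in>antidiag (m + ?e) - ?h ` antidiag m. (case p of (a, b) \<Rightarrow> ?l a * mfps_nth f a * mfps_nth g b) = 0"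
      proof clarify
        fix a b assume ab: "(a, b) \<in> antidiag (m + ?e)" "(a, b) \<notin> ?h ` antidiag m"
        have "Poly_Mapping.lookup a i = 0"
        proof (rule ccontr)
          assume "Poly_Mapping.lookup a i \<noteq> 0"
          then obtain a' where "a = a' + ?e"
            using le_lookup_iff_add[of 1 a i] by (auto simp: add.commute)
          moreover from this have "(a', b) \<in> antidiag m"
            using ab(1) by (simp add: antidiag_def) (metis add.assoc add.commute add_right_cancel)
          ultimately show False using ab(2) by force
        qed
        then show "?l a * mfps_nth f a * mfps_nth g b = 0" by simp
      qed
    qed (auto simp: antidiag_def ac_simps)
    also have "\<dots> = mfps_nth (mfps_pderiv i f * g) m"
      unfolding mfps_nth_mult
      by (subst sum.reindex[OF inj], rule sum.cong) (auto simp: lookup_add)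
    finally show ?thesis by simp
  qed
  have right: "mfps_nth (f * mfps_pderiv i g) m =
      (\<Sum>(a, b)\<in>antidiag (m + ?e). ?l b * mfps_nth f a * mfps_nth g b)"
    unfolding mult.commute[of f] left
    by (rule sum.reindex_bij_witness[where i = prod.swap and j = prod.swap])
      (auto simp: antidiag_def ac_simps)
  have "mfps_nth (mfps_pderiv i (f * g)) m =
      (\<Sum>(a, b)\<in>antidiag (m + ?e). (?l a + ?l b) * (mfps_nth f a * mfps_nth g b))"
    unfolding mfps_nth_pderiv mfps_nth_mult sum_distrib_left
  proof (rule sum.cong[OF refl], clarify)
    fix a b assume "(a, b) \<in> antidiag (m + ?e)"
    then have "Suc (Poly_Mapping.lookup m i) = Poly_Mapping.lookup a i + Poly_Mapping.lookup b i"
      by (auto simp: antidiag_def lookup_add dest!: arg_cong[of _ _ "\<lambda>m. Poly_Mapping.lookup m i"])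
    then show "of_nat (Suc (Poly_Mapping.lookup m i)) * (mfps_nth f a * mfps_nth g b) =
        (?l a + ?l b) * (mfps_nth f a * mfps_nth g b)" by (simp only: of_nat_add)
  qed
  also have "\<dots> = mfps_nth (mfps_pderiv i f * g) m + mfps_nth (f * mfps_pderiv i g) m"
    unfolding left right sum.distrib[symmetric]
    by (rule sum.cong) (auto simp: algebra_simps)
  finally show "mfps_nth (mfps_pderiv i (f * g)) m = mfps_nth (mfps_pderiv i f * g + f * mfps_pderiv i g) m"
    by simp
qed

section \<open>Ideals of finite codimension\<close>

text \<open>Additive inverses are multiples by -1, so these closure properties suffice.\<close>

lemma ideal_class_ring_iff:
  fixes I :: "'r::comm_ring_1 set"
  shows "ideal I class_ring \<longleftrightarrow>
    0 \<in> I \<and> (\<forall>x\<in>I. \<forall>y\<in>I. x + y \<in> I) \<and> (\<forall>r. \<forall>x\<in>I. r * x \<in> I)"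
proof
  assume "ideal I class_ring"
  then interpret I: ideal I class_ring .
  show "0 \<in> I \<and> (\<forall>x\<in>I. \<forall>y\<in>I. x + y \<in> I) \<and> (\<forall>r. \<forall>x\<in>I. r * x \<in> I)"
    using I.zero_closed I.a_closed I.I_l_closed by auto
next
  assume I: "0 \<in> I \<and> (\<forall>x\<in>I. \<forall>y\<in>I. x + y \<in> I) \<and> (\<forall>r. \<forall>x\<in>I. r * x \<in> I)"
  have I': "a * x \<in> I" if "a \<in> I" for a x
    using I that by (metis mult.commute)
  show "ideal I class_ring"
  proof (rule idealI)
    show "ring (class_ring :: 'r ring)" by (rule class_ring.ring_axioms)
    show "subgroup I (add_monoid class_ring)"
    proof (rule group.subgroupI)
      show "group (add_monoid (class_ring :: 'r ring))" by (rule abelian_group.a_group[OF ring.is_abelian_group[OF class_ring.ring_axioms]])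
      fix a assume a: "a \<in> I"
      have "inv\<^bsub>add_monoid class_ring\<^esub> a = - a"
        using class_ring_simps by (metis a_inv_def)
      moreover have "- a \<in> I" using I a by (metis mult_minus1)
      ultimately show "inv\<^bsub>add_monoid class_ring\<^esub> a \<in> I" by simp
    qed (use I in auto)
  qed (use I I' in auto)
qed

lemma ideal_class_ringD:
  fixes I :: "'r::comm_ring_1 set"
  assumes "ideal I class_ring"
  shows "0 \<in> I" "x \<in> I \<Longrightarrow> y \<in> I \<Longrightarrow> x + y \<in> I" "x \<in> I \<Longrightarrow> r * x \<in> I"
    "x \<in> I \<Longrightarrow> y \<in> I \<Longrightarrow> x - y \<in> I" "x \<in> I \<Longrightarrow> x * r \<in> I"
proof -
  have I: "0 \<in> I" "\<And>x y. x \<in> I \<Longrightarrow> y \<in> I \<Longrightarrow> x + y \<in> I" "\<And>r x. x \<in> I \<Longrightarrow> r * x \<in> I"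
    using assms unfolding ideal_class_ring_iff by auto
  show "0 \<in> I" "x \<in> I \<Longrightarrow> y \<in> I \<Longrightarrow> x + y \<in> I" "x \<in> I \<Longrightarrow> r * x \<in> I" by (fact I)+
  show "x - y \<in> I" if "x \<in> I" "y \<in> I"
    using I(2)[OF that(1) I(3)[OF that(2), of "- 1"]] by simp
  show "x * r \<in> I" if "x \<in> I" using I(3)[OF that, of r] by (simp add: mult.commute)
qed

lemma ideal_class_ring_sum:
  fixes I :: "'r::comm_ring_1 set"
  assumes "ideal I class_ring" "\<And>k. k \<in> F \<Longrightarrow> h k \<in> I"
  shows "(\<Sum>k\<in>F. h k) \<in> I"
  using assms(2)
  by (induction F rule: infinite_finite_induct) (simp_all add: ideal_class_ringD[OF assms(1)])

text \<open>For an ideal \<open>I\<close> this is I + tR.\<close>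

definition ideal_adjoin :: "'r::comm_ring_1 set \<Rightarrow> 'r \<Rightarrow> 'r set" where
  "ideal_adjoin I t = {g. \<exists>u. g - t * u \<in> I}"

lemma ideal_ideal_adjoin:
  fixes I :: "'r::comm_ring_1 set"
  assumes "ideal I class_ring"
  shows "ideal (ideal_adjoin I t) class_ring"
  unfolding ideal_class_ring_iff
proof (intro conjI ballI allI)
  note I = ideal_class_ringD[OF assms]
  show "0 \<in> ideal_adjoin I t" by (auto simp: ideal_adjoin_def I intro: exI[of _ 0])
  fix x assume "x \<in> ideal_adjoin I t"
  then obtain u where u: "x - t * u \<in> I" by (auto simp: ideal_adjoin_def)
  show "r * x \<in> ideal_adjoin I t" for r
    using I(3)[OF u, of r] by (auto simp: ideal_adjoin_def algebra_simps intro: exI[of _ "r * u"])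
  fix y assume "y \<in> ideal_adjoin I t"
  then obtain v where v: "y - t * v \<in> I" by (auto simp: ideal_adjoin_def)
  show "x + y \<in> ideal_adjoin I t"
    using I(2)[OF u v] by (auto simp: ideal_adjoin_def algebra_simps intro: exI[of _ "u + v"])
qed

text \<open>With the partial derivatives for \<open>S\<close> and \<open>f\<close> for
  \<open>t\<close>, this exhibits the Tjurina ideal as J + fR.\<close>

lemma genideal_insert_eq_adjoin:
  fixes S :: "'r::comm_ring_1 set"
  shows "Idl\<^bsub>class_ring\<^esub> (insert t S) = ideal_adjoin (Idl\<^bsub>class_ring\<^esub> S) t"
proof
  let ?J = "Idl\<^bsub>class_ring\<^esub> S" and ?T = "Idl\<^bsub>class_ring\<^esub> (insert t S)"
  have J: "ideal ?J class_ring" and T: "ideal ?T class_ring"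
    by (intro ring.genideal_ideal[OF class_ring.ring_axioms]; simp)+
  have S: "S \<subseteq> ?J" and tS: "insert t S \<subseteq> ?T"
    by (intro ring.genideal_self[OF class_ring.ring_axioms]; simp)+
  note J' = ideal_class_ringD[OF J] and T' = ideal_class_ringD[OF T]
  show "?T \<subseteq> ideal_adjoin ?J t"
  proof (rule ring.genideal_minimal[OF class_ring.ring_axioms ideal_ideal_adjoin[OF J]])
    have "t \<in> ideal_adjoin ?J t" by (auto simp: ideal_adjoin_def J' intro: exI[of _ 1])
    moreover have "x \<in> ideal_adjoin ?J t" if "x \<in> S" for x
      using that S by (auto simp: ideal_adjoin_def intro!: exI[of _ 0])
    ultimately show "insert t S \<subseteq> ideal_adjoin ?J t" by blast
  qed
  have JT: "?J \<subseteq> ?T" by (rule ring.genideal_minimal[OF class_ring.ring_axioms T]) (use tS in auto)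
  show "ideal_adjoin ?J t \<subseteq> ?T"
  proof
    fix g assume "g \<in> ideal_adjoin ?J t"
    then obtain u where "g - t * u \<in> ?T" using JT by (auto simp: ideal_adjoin_def)
    moreover have "t * u \<in> ?T" using tS by (auto intro: T'(5))
    ultimately show "g \<in> ?T" using T'(2) by fastforce
  qed
qed

interpretation mfps_vs: vector_space "\<lambda>c (g :: ('a::field, 'n) mfps). mfps_const c * g"
  by unfold_locales (simp_all add: mfps_const_ring_hom algebra_simps)

text \<open>Phrased with representatives in the ring instead of cosets, so that later arguments can
  compute with power series.\<close>

definition finite_codim :: "('a::field, 'n) mfps set \<Rightarrow> bool" where
  "finite_codim I \<longleftrightarrow> (\<exists>B. finite B \<and> (\<forall>g. \<exists>s\<in>mfps_vs.span B. g - s \<in> I))"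

lemma finite_codim_adjoin_iff:
  "finite_codim (ideal_adjoin I f) \<longleftrightarrow>
    (\<exists>B. finite B \<and> (\<forall>g. \<exists>s\<in>mfps_vs.span B. \<exists>u. g - s - f * u \<in> I))"
  unfolding finite_codim_def ideal_adjoin_def mem_Collect_eq ..

lemma finite_codim_mono:
  assumes "finite_codim I" "I \<subseteq> J"
  shows "finite_codim J"
proof -
  obtain B where B: "finite B" "\<forall>g. \<exists>s\<in>mfps_vs.span B. g - s \<in> I"
    using assms(1) unfolding finite_codim_def by (elim exE conjE)
  have "\<exists>s\<in>mfps_vs.span B. g - s \<in> J" for g
  proof -
    obtain s where "s \<in> mfps_vs.span B" "g - s \<in> I" using B(2) by blast
    with assms(2) show ?thesis by (intro bexI[of _ s]) auto
  qed
  with B(1) show ?thesis unfolding finite_codim_def by (intro exI[of _ B] conjI allI)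
qed

text \<open>Representatives of finitely many spanning cosets span modulo \<open>I\<close>;
  conversely, cosets of spanning series span the quotient.\<close>

lemma fin_dim_mfps_quot_iff:
  fixes I :: "('a::field, 'n) mfps set"
  assumes "ideal I class_ring"
  shows "vectorspace.fin_dim (class_ring :: 'a ring) (mfps_quot I) \<longleftrightarrow> finite_codim I"
proof -
  let ?R = "class_ring :: ('a, 'n) mfps ring" and ?K = "class_ring :: 'a ring"
  let ?V = "mfps_quot I" and ?p = "\<lambda>x. I +>\<^bsub>?R\<^esub> x"
  interpret I: ideal I ?R by fact
  interpret V: vectorspace ?K ?V by (rule vectorspace_mfps_quot[OF assms])
  have hom: "(+>\<^bsub>?R\<^esub>) I \<in> Ring.ring_hom ?R (?R Quot I)" by (rule I.rcos_ring_hom)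
  have carrier: "carrier ?V = range ?p"
    by (auto simp: mfps_quot_def Let_def FactRing_def A_RCOSETS_def RCOSETS_def a_r_coset_def)
  have add: "?p x \<oplus>\<^bsub>?V\<^esub> ?p y = ?p (x + y)" for x y
    using ring_hom_add[OF hom, of x y] by (simp add: mfps_quot_def Let_def)
  have smult: "c \<odot>\<^bsub>?V\<^esub> ?p x = ?p (mfps_const c * x)" for c x
    using ring_hom_mult[OF hom, of "mfps_const c" x] by (simp add: mfps_quot_def Let_def)
  have zero: "\<zero>\<^bsub>?V\<^esub> = ?p 0"
    by (simp add: mfps_quot_def Let_def FactRing_def a_r_coset_def r_coset_def)
  have eq: "?p x = ?p y \<longleftrightarrow> x - y \<in> I" for x y
    using ring.quotient_eq_iff_same_a_r_cos[OF class_ring.ring_axioms assms, of x y] by (simp add: class_ring_simps)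
  have finsum: "(\<Oplus>\<^bsub>?V\<^esub>v\<in>A. ?p (g v)) = ?p (\<Sum>v\<in>A. g v)" if "finite A" for g and A :: "'x set"
    using that
    by (induction A rule: finite_induct) (auto simp: zero add carrier)
  show ?thesis
  proof
    assume "V.fin_dim"
    then obtain A where A: "finite A" "A \<subseteq> carrier ?V" "V.span A = carrier ?V"
      unfolding V.fin_dim_def by blast
    define r where "r = (\<lambda>X. SOME x. X = ?p x)"
    have r: "X = ?p (r X)" if "X \<in> A" for X
      unfolding r_def by (rule someI_ex) (use that A(2) carrier in blast)
    have "\<exists>s\<in>mfps_vs.span (r ` A). g - s \<in> I" for g
    proof -
      have "?p g \<in> V.span A" using A(3) carrier by auto
      then obtain a where "?p g = V.lincomb a A"
        unfolding V.finite_span[OF A(1,2)] by blast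
      also have "\<dots> = (\<Oplus>\<^bsub>?V\<^esub>X\<in>A. ?p (mfps_const (a X) * r X))"
        unfolding V.lincomb_def
      proof (rule V.finsum_cong')
        show "a X \<odot>\<^bsub>?V\<^esub> X = ?p (mfps_const (a X) * r X)" if "X \<in> A" for X
          using smult[of "a X" "r X"] r[OF that] by simp
      qed (auto simp: carrier)
      also have "\<dots> = ?p (\<Sum>X\<in>A. mfps_const (a X) * r X)" by (rule finsum[OF A(1)])
      finally have "g - (\<Sum>X\<in>A. mfps_const (a X) * r X) \<in> I" by (simp add: eq)
      then show ?thesis
        by (rule bexI) (intro mfps_vs.span_sum mfps_vs.span_scale mfps_vs.span_base imageI)
    qed
    then show "finite_codim I" unfolding finite_codim_def using A(1) by blast
  next
    assume "finite_codim I"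
    then obtain B where B: "finite B" "\<And>g. \<exists>s\<in>mfps_vs.span B. g - s \<in> I"
      unfolding finite_codim_def by blast
    have sub: "?p ` B \<subseteq> carrier ?V" using carrier by auto
    interpret S: LinearCombinations.submodule ?K "V.span (?p ` B)" ?V
      by (rule V.span_is_submodule[OF sub])
    have "?p s \<in> V.span (?p ` B)" if "s \<in> mfps_vs.span B" for s
      using that
    proof (induction rule: mfps_vs.span_induct_alt)
      case base
      then show ?case using S.zero_closed by (simp add: zero)
    next
      case (step c x y)
      then have "c \<odot>\<^bsub>?V\<^esub> ?p x \<in> V.span (?p ` B)"
        using V.in_own_span[OF sub] by (intro S.smult_closed) auto
      then have "c \<odot>\<^bsub>?V\<^esub> ?p x \<oplus>\<^bsub>?V\<^esub> ?p y \<in> V.span (?p ` B)"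
        by (rule S.m_closed) (rule step)
      then show ?case by (simp add: smult add)
    qed
    then have "?p g \<in> V.span (?p ` B)" for g
      using B(2)[of g] eq by metis
    then have "V.span (?p ` B) = carrier ?V"
      using V.span_is_subset2[OF sub] carrier by auto
    then show "V.fin_dim" unfolding V.fin_dim_def using B(1) sub by blast
  qed
qed


section \<open>Consequences of finite codimension\<close>

lemma mfps_nth_power_0: "mfps_nth (x ^ k) 0 = mfps_nth x 0 ^ k"
  by (induction k) simp_all

text \<open>The powers of \<open>x\<close> are linearly dependent modulo \<open>T\<close>. Factoring
  the lowest power out of a relation leaves a series with nonzero constant term, that is a
  unit.\<close>

lemma power_in_ideal_if_finite_codim:
  fixes T :: "('a::field, 'n::finite) mfps set"
  assumes T: "ideal T class_ring" and fin: "finite_codim T" and x: "mfps_nth x 0 = 0"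
  shows "\<exists>s. x ^ s \<in> T"
proof -
  note T' = ideal_class_ringD[OF T]
  obtain B where B: "finite B" "\<And>g. \<exists>s\<in>mfps_vs.span B. g - s \<in> T"
    using fin unfolding finite_codim_def by blast
  have "\<exists>s. s \<in> mfps_vs.span B \<and> x ^ k - s \<in> T" for k using B(2) by blast
  then obtain w where w: "\<And>k. w k \<in> mfps_vs.span B" "\<And>k. x ^ k - w k \<in> T" by metis
  have "\<exists>F d. finite F \<and> (\<Sum>k\<in>F. mfps_const (d k) * w k) = 0 \<and> (\<exists>k\<in>F. d k \<noteq> 0)"
  \<comment> \<open>Linear dependence of \<open>range w\<close> sees no repetitions. An injective
    \<open>w\<close> has infinite range in a finite-dimensional span; a repeated value gives a
    relation with coefficients 1 and -1.\<close>
  proof (cases "inj w")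
    case True
    then have "infinite (range w)" by (simp add: finite_image_iff)
    then have "mfps_vs.dependent (range w)"
      using mfps_vs.independent_span_bound[OF B(1), of "range w"] w(1) by blast
    then obtain S u where S: "finite S" "S \<subseteq> range w" "(\<Sum>v\<in>S. mfps_const (u v) * v) = 0" "\<exists>v\<in>S. u v \<noteq> 0"
      unfolding mfps_vs.dependent_explicit by blast
    have "bij_betw w (w -` S) S"
      using True S(2) by (auto simp: bij_betw_def inj_on_def)
    then have "(\<Sum>k\<in>w -` S. mfps_const (u (w k)) * w k) = 0"
      unfolding S(3)[symmetric] by (rule sum.reindex_bij_betw)
    moreover obtain v where v: "v \<in> S" "u v \<noteq> 0" using S(4) by blast
    obtain k where "v = w k" using S(2) v(1) by auto
    then have "\<exists>k\<in>w -` S. u (w k) \<noteq> 0" using v by (intro bexI[of _ k]) auto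
    ultimately show ?thesis using finite_vimageI[OF S(1) True]
      by (intro exI[of _ "w -` S"] exI[of _ "\<lambda>k. u (w k)"] conjI)
  next
    case False
    then obtain j k where jk: "j \<noteq> k" "w j = w k" by (auto simp: inj_def)
    then have "(\<Sum>l\<in>{j, k}. mfps_const (if l = j then 1 else - 1) * w l) = 0"
      by (simp add: mfps_const_ring_hom distrib_right[symmetric] flip: mfps_const_ring_hom(1))
    then show ?thesis by (intro exI[of _ "{j, k}"] exI[of _ "\<lambda>l. if l = j then 1 else - 1"]) auto
  qed
  then obtain F d where F: "finite F" "(\<Sum>k\<in>F. mfps_const (d k) * w k) = 0" "\<exists>k\<in>F. d k \<noteq> 0"
    by blast
  \<comment> \<open>Dropping zero coefficients ensures that the least exponent \<open>s\<close> has
    a nonzero one, which becomes the constant term of the cofactor.\<close>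
  define G where "G = {k \<in> F. d k \<noteq> 0}"
  have G: "finite G" "G \<noteq> {}" using F by (auto simp: G_def)
  define s where "s = Min G"
  have s: "s \<in> G" "\<And>k. k \<in> G \<Longrightarrow> s \<le> k" using G by (simp_all add: s_def)
  have "(\<Sum>k\<in>F. mfps_const (d k) * (x ^ k - w k)) \<in> T"
    by (intro ideal_class_ring_sum[OF T] T'(3) w)
  then have "(\<Sum>k\<in>F. mfps_const (d k) * x ^ k) \<in> T"
    using F(2) by (simp add: right_diff_distrib sum_subtractf)
  also have "(\<Sum>k\<in>F. mfps_const (d k) * x ^ k) = (\<Sum>k\<in>G. mfps_const (d k) * x ^ k)"
    by (rule sum.mono_neutral_right) (use F in \<open>auto simp: G_def\<close>)
  also have "\<dots> = x ^ s * (\<Sum>k\<in>G. mfps_const (d k) * x ^ (k - s))"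
    unfolding sum_distrib_left
    by (rule sum.cong[OF refl]) (simp add: s mult.left_commute flip: power_add)
  finally have mem: "x ^ s * (\<Sum>k\<in>G. mfps_const (d k) * x ^ (k - s)) \<in> T" .
  have "mfps_nth (\<Sum>k\<in>G. mfps_const (d k) * x ^ (k - s)) 0 = (\<Sum>k\<in>G. if k = s then d s else 0)"
    unfolding mfps_nth_sum
  proof (rule sum.cong[OF refl])
    fix k assume "k \<in> G"
    then show "mfps_nth (mfps_const (d k) * x ^ (k - s)) 0 = (if k = s then d s else 0)"
      using s(2)[of k] by (simp add: mfps_nth_power_0 x power_0_left)
  qed
  also have "\<dots> \<noteq> 0" using G s by (simp add: G_def)
  finally have "mfps_nth (\<Sum>k\<in>G. mfps_const (d k) * x ^ (k - s)) 0 \<noteq> 0" .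
  from mfps_invertible[OF this] obtain v where v: "(\<Sum>k\<in>G. mfps_const (d k) * x ^ (k - s)) * v = 1" ..
  have "x ^ s * (\<Sum>k\<in>G. mfps_const (d k) * x ^ (k - s)) * v \<in> T" by (rule T'(5)[OF mem])
  then have "x ^ s \<in> T" unfolding mult.assoc v mult_1_right .
  then show ?thesis by (rule exI)
qed

text \<open>Pass from J + f^n R to J + f^(n+1) R: adding f^n times generators modulo J + fR to the
  old ones gives a spanning set. For n = k the ideal is \<open>J\<close>.\<close>

lemma finite_codim_if_power_in:
  fixes J :: "('a::field, 'n) mfps set"
  assumes J: "ideal J class_ring" and fin: "finite_codim (ideal_adjoin J f)" and f: "f ^ k \<in> J"
  shows "finite_codim J"
proof -
  note J' = ideal_class_ringD[OF J]
  obtain B where B: "finite B" "\<forall>g. \<exists>s\<in>mfps_vs.span B. \<exists>u. g - s - f * u \<in> J"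
    using fin unfolding finite_codim_adjoin_iff by (elim exE conjE)
  have claim: "\<exists>C. finite C \<and> (\<forall>g. \<exists>s\<in>mfps_vs.span C. \<exists>u. g - s - f ^ n * u \<in> J)" for n
  proof (induction n)
    case 0
    show ?case
    proof (intro exI[of _ "{}"] conjI allI)
      fix g
      have "g - 0 - f ^ 0 * g \<in> J" by (simp add: J')
      then show "\<exists>s\<in>mfps_vs.span {}. \<exists>u. g - s - f ^ 0 * u \<in> J"
        using mfps_vs.span_zero by blast
    qed simp
  next
    case (Suc n)
    then obtain C where C: "finite C" "\<And>g. \<exists>s\<in>mfps_vs.span C. \<exists>u. g - s - f ^ n * u \<in> J" by blast
    let ?D = "C \<union> (\<lambda>b. f ^ n * b) ` B"
    have span: "f ^ n * s \<in> mfps_vs.span ?D" if "s \<in> mfps_vs.span B" for s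
      using that
    proof (induction rule: mfps_vs.span_induct_alt)
      case base
      then show ?case by (simp add: mfps_vs.span_zero)
    next
      case (step c x y)
      have "f ^ n * x \<in> mfps_vs.span ?D" by (rule mfps_vs.span_base) (simp add: step)
      then have "mfps_const c * (f ^ n * x) + f ^ n * y \<in> mfps_vs.span ?D"
        by (intro mfps_vs.span_add[OF mfps_vs.span_scale step(2)])
      moreover have "f ^ n * (mfps_const c * x + y) = mfps_const c * (f ^ n * x) + f ^ n * y"
        by (simp add: distrib_left mult.left_commute)
      ultimately show ?case by simp
    qed
    have "\<exists>s\<in>mfps_vs.span ?D. \<exists>u. g - s - f ^ Suc n * u \<in> J" for g
    proof -
      obtain s u where s: "s \<in> mfps_vs.span C" "g - s - f ^ n * u \<in> J" using C(2) by blast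
      obtain s' u' where s': "s' \<in> mfps_vs.span B" "u - s' - f * u' \<in> J" using B(2) by blast
      have "s \<in> mfps_vs.span ?D" by (rule subsetD[OF mfps_vs.span_mono s(1)]) simp
      then have "s + f ^ n * s' \<in> mfps_vs.span ?D" by (intro mfps_vs.span_add span s')
      moreover have eq: "g - (s + f ^ n * s') - f ^ Suc n * u' = (g - s - f ^ n * u) + f ^ n * (u - s' - f * u')"
        by (simp add: algebra_simps)
      have "g - (s + f ^ n * s') - f ^ Suc n * u' \<in> J"
        unfolding eq by (rule J'(2)[OF s(2) J'(3)[OF s'(2)]])
      ultimately show ?thesis by (intro bexI exI)
    qed
    moreover have "finite ?D" using B(1) C(1) by simp
    ultimately show ?case by (intro exI[of _ ?D] conjI allI)
  qed
  obtain C where C: "finite C" "\<And>g. \<exists>s\<in>mfps_vs.span C. \<exists>u. g - s - f ^ k * u \<in> J"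
    using claim[of k] by blast
  have "\<exists>s\<in>mfps_vs.span C. g - s \<in> J" for g
  proof -
    obtain s u where s: "s \<in> mfps_vs.span C" "g - s - f ^ k * u \<in> J" using C(2) by blast
    have "(g - s - f ^ k * u) + f ^ k * u \<in> J" by (rule J'(2)[OF s(2) J'(5)[OF f]])
    then have "g - s \<in> J" by simp
    then show ?thesis using s(1) by (rule bexI)
  qed
  with C(1) show ?thesis unfolding finite_codim_def by (intro exI[of _ C] conjI allI)
qed

lemma adic_basis_exists:
  fixes I :: "('a::field, 'n) mfps set"
  assumes I: "ideal I class_ring" and nonzerodivisor: "\<And>g. f * g \<in> I \<Longrightarrow> g \<in> I"
    and fin: "finite_codim (ideal_adjoin I f)"
  shows "\<exists>B. adic_basis mfps_const I f B"
proof -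
  note I' = ideal_class_ringD[OF I]
  define P where "P = (\<lambda>B. finite B \<and> (\<forall>g. \<exists>c u. g - ((\<Sum>b\<in>B. mfps_const (c b) * b) + f * u) \<in> I))"
  obtain B0 where B0: "finite B0" "\<forall>g. \<exists>s\<in>mfps_vs.span B0. \<exists>u. g - s - f * u \<in> I"
    using fin unfolding finite_codim_adjoin_iff by (elim exE conjE)
  have "P B0"
    unfolding P_def
  proof (intro conjI allI B0)
    fix g
    obtain s u where s: "s \<in> mfps_vs.span B0" "g - s - f * u \<in> I" using B0(2) by blast
    obtain c where "s = (\<Sum>b\<in>B0. mfps_const (c b) * b)"
      using s(1) unfolding mfps_vs.span_finite[OF B0(1)] by (rule imageE)
    with s(2) have "g - ((\<Sum>b\<in>B0. mfps_const (c b) * b) + f * u) \<in> I" by (simp only: diff_diff_eq)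
    then show "\<exists>c u. g - ((\<Sum>b\<in>B0. mfps_const (c b) * b) + f * u) \<in> I" by (intro exI)
  qed
  from ex_has_least_nat[of P B0 card, OF this]
  obtain B where B: "P B" and least: "\<And>B'. P B' \<Longrightarrow> card B \<le> card B'" by blast
  have finite_B: "finite B" using B by (simp add: P_def)
  have indep: "c b0 = 0" if z: "(\<Sum>b\<in>B. mfps_const (c b) * b) + f * u \<in> I" and b0: "b0 \<in> B" for c u b0
  proof (rule ccontr)
    assume c0: "c b0 \<noteq> 0"
    have "P (B - {b0})"
      unfolding P_def
    proof (intro conjI allI)
      fix g
      obtain d v where dv: "g - ((\<Sum>b\<in>B. mfps_const (d b) * b) + f * v) \<in> I"
        using B unfolding P_def by (elim conjE allE[of _ g] exE)
      \<comment> \<open>Subtracting \<open>r\<close> times the relation from the expansion of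
        \<open>g\<close> cancels the coefficient of \<open>b0\<close>.\<close>
      define r where "r = d b0 / c b0"
      define e where "e = (\<lambda>b. d b - r * c b)"
      have const_diff: "mfps_const (x - y) = mfps_const x - (mfps_const y :: ('a, 'n) mfps)" for x y
        by (rule mfps_eqI) simp
      have "e b0 = 0" using c0 by (simp add: e_def r_def)
      then have "(\<Sum>b\<in>B - {b0}. mfps_const (e b) * b) = (\<Sum>b\<in>B. mfps_const (e b) * b)"
        by (intro sum.mono_neutral_left) (auto simp: finite_B)
      also have "\<dots> =
          (\<Sum>b\<in>B. mfps_const (d b) * b) - mfps_const r * (\<Sum>b\<in>B. mfps_const (c b) * b)"
      proof -
        have "mfps_const (e b) * b = mfps_const (d b) * b - mfps_const r * (mfps_const (c b) * b)" for b
          by (simp only: e_def const_diff mfps_const_ring_hom(2) left_diff_distrib mult.assoc)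
        then show ?thesis by (simp only: sum_subtractf sum_distrib_left)
      qed
      finally have e: "(\<Sum>b\<in>B - {b0}. mfps_const (e b) * b) =
          (\<Sum>b\<in>B. mfps_const (d b) * b) - mfps_const r * (\<Sum>b\<in>B. mfps_const (c b) * b)" .
      have "g - ((\<Sum>b\<in>B - {b0}. mfps_const (e b) * b) + f * (v - mfps_const r * u)) =
          (g - ((\<Sum>b\<in>B. mfps_const (d b) * b) + f * v)) + mfps_const r * ((\<Sum>b\<in>B. mfps_const (c b) * b) + f * u)"
        unfolding e by (simp add: algebra_simps)
      also have "\<dots> \<in> I" by (intro I'(2) I'(3) dv z)
      finally show "\<exists>c u. g - ((\<Sum>b\<in>B - {b0}. mfps_const (c b) * b) + f * u) \<in> I" by (intro exI)
    qed (use finite_B in simp)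
    from least[OF this] show False using card_Diff1_less[OF finite_B b0] by simp
  qed
  have "adic_basis mfps_const I f B"
  proof
    show "\<exists>c u. g - ((\<Sum>b\<in>B. mfps_const (c b) * b) + f * u) \<in> I" for g
      using B unfolding P_def by (elim conjE allE[of _ g])
    show "c b = 0" if "(\<Sum>b\<in>B. mfps_const (c b) * b) + f * u \<in> I" "b \<in> B" for c u b
      by (rule indep[OF that])
  qed (fact mfps_const_ring_hom I' nonzerodivisor finite_B)+
  then show ?thesis ..
qed

text \<open>The classical chain rule argument: on a curve contained in the critical locus the function
  is constant. Here the curve is replaced by the trace of the regular representation.\<close>

lemma power_in_ideal_of_pderivs:
  fixes f :: "('a::field_char_0, 'n::finite) mfps"
  assumes J: "ideal J class_ring" and pderiv: "\<And>i. mfps_pderiv i f \<in> J"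
    and f: "mfps_nth f 0 = 0" and fin: "finite_codim (ideal_adjoin J f)"
  shows "\<exists>k. f ^ k \<in> J"
proof (rule ccontr)
  assume no_power: "\<nexists>k. f ^ k \<in> J"
  note J' = ideal_class_ringD[OF J]
  define I where "I = {g. \<exists>k. f ^ k * g \<in> J}"
  have JI: "J \<subseteq> I" by (auto simp: I_def intro: exI[of _ 0])
  have I: "ideal I class_ring"
    unfolding ideal_class_ring_iff
  proof (intro conjI ballI allI)
    show "0 \<in> I" using JI J' by blast
    fix x assume "x \<in> I"
    then obtain k where k: "f ^ k * x \<in> J" by (auto simp: I_def)
    show "r * x \<in> I" for r
      using J'(3)[OF k, of r] by (auto simp: I_def mult.left_commute intro!: exI[of _ k])
    fix y assume "y \<in> I"
    then obtain l where l: "f ^ l * y \<in> J" by (auto simp: I_def)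
    have "f ^ (k + l) * (x + y) = f ^ l * (f ^ k * x) + f ^ k * (f ^ l * y)"
      by (simp add: power_add algebra_simps)
    then have "f ^ (k + l) * (x + y) \<in> J" using J'(2)[OF J'(3)[OF k] J'(3)[OF l]] by simp
    then show "x + y \<in> I" by (auto simp: I_def)
  qed
  note I' = ideal_class_ringD[OF I]
  have nonzerodivisor: "g \<in> I" if fg: "f * g \<in> I" for g
  proof -
    obtain k where "f ^ k * (f * g) \<in> J" using fg by (auto simp: I_def)
    then have "f ^ Suc k * g \<in> J" by (simp add: ac_simps)
    then show ?thesis unfolding I_def by blast
  qed
  have "ideal_adjoin J f \<subseteq> ideal_adjoin I f" using JI by (auto simp: ideal_adjoin_def)
  with fin have fin_I: "finite_codim (ideal_adjoin I f)" by (rule finite_codim_mono)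
  obtain B where B: "adic_basis mfps_const I f B"
    using adic_basis_exists[OF I nonzerodivisor fin_I] by blast
  interpret adic_basis mfps_const I f B by (rule B)
  \<comment> \<open>An empty basis would give R = I + fR. Since \<open>f\<close> has no constant
    term, \<open>1 - f * u\<close> is a unit, so a power of \<open>f\<close> would lie in
    \<open>J\<close>.\<close>
  have "B \<noteq> {}"
  proof
    assume "B = {}"
    then obtain u where "1 - f * u \<in> I" using spanning[of 1] by auto
    then obtain k where k: "f ^ k * (1 - f * u) \<in> J" by (auto simp: I_def)
    obtain v where "(1 - f * u) * v = 1"
      using mfps_one_minus_invertible[of "f * u"] f by auto
    then have "f ^ k \<in> J" using J'(5)[OF k, of v] by (simp add: mult.assoc)
    with no_power show False by blast
  qed
  then have card_B: "card B \<noteq> 0" using finite_B by simp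
  \<comment> \<open>Defect of the chain rule. The multiplier \<open>h\<close> is an argument because
    the Leibniz rule moves factors of \<open>g\<close> into it.\<close>
  define E where "E = (\<lambda>h g. trace_form h g - (\<Sum>i\<in>UNIV. trace_form (h * mfps_pderiv i g) (mfps_X i)))"
  have E_add: "E h (g + k) = E h g + E h k" for h g k
    by (simp add: E_def trace_form_add_right mfps_pderiv_add distrib_left trace_form_add_left sum.distrib)
  have E_mult: "E h (g * k) = E (h * k) g + E (h * g) k" for h g k
  proof -
    have "h * mfps_pderiv i (g * k) = h * k * mfps_pderiv i g + h * g * mfps_pderiv i k" for i
      by (simp add: mfps_pderiv_mult algebra_simps)
    then show ?thesis
      by (simp add: E_def trace_form_mult_right trace_form_add_left sum.distrib)
  qed
  have trace_0: "trace_form 0 g = 0" for g by (rule trace_form_in[OF zero_in])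
  have E_finite_support: "E h g = 0" if "finite {m. mfps_nth g m \<noteq> 0}" for h g
  proof -
    \<comment> \<open>Quantifying over \<open>h\<close> is essential: the product case uses the
      hypotheses at other multipliers.\<close>
    have "\<forall>h. E h g = 0"
      using that
    proof (induction rule: mfps_finite_support_induct)
      case (X i)
      have "(\<Sum>j\<in>UNIV. trace_form (h * mfps_pderiv j (mfps_X i)) (mfps_X j)) =
          (\<Sum>j\<in>UNIV. if j = i then trace_form h (mfps_X i) else 0)" for h
        by (rule sum.cong) (simp_all add: mfps_pderiv_X trace_0)
      then show ?case by (simp add: E_def)
    qed (simp_all add: E_add E_mult, simp add: E_def trace_form_emb trace_0)
    then show ?thesis by blast
  qed
  have E_in: "E h g = 0" if "h \<in> I" for h g
    using that by (simp add: E_def trace_form_in I')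
  have E_add_left: "E (h + k) g = E h g + E k g" for h g k
    by (simp add: E_def trace_form_add_left distrib_right sum.distrib)
  have E_f: "E (f * h) g = fps_X * E h g" for h g
    by (simp add: E_def trace_form_mult_t mult.assoc right_diff_distrib sum_distrib_left)
  have E_f_power: "E (f ^ q * h) g = fps_X ^ q * E h g" for q h g
  proof (induction q arbitrary: h)
    case (Suc q)
    have "E (f ^ Suc q * h) g = E (f * (f ^ q * h)) g" by (simp only: power_Suc mult.assoc)
    also have "\<dots> = fps_X ^ Suc q * E h g" by (simp only: E_f Suc power_Suc mult.assoc)
    finally show ?case .
  qed simp
  \<comment> \<open>The variables are nilpotent modulo I + fR, which has finite codimension.\<close>
  have X_power: "\<exists>s. mfps_X i ^ s \<in> ideal_adjoin I f" for i
    by (rule power_in_ideal_if_finite_codim[OF ideal_ideal_adjoin[OF I] fin_I]) simp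
  have power_adjoin: "\<exists>u. x ^ q - f ^ q * u \<in> I" if x: "x \<in> ideal_adjoin I f" for x q
  proof -
    obtain u where u: "x - f * u \<in> I" using x by (auto simp: ideal_adjoin_def)
    have "x ^ q - (f * u) ^ q \<in> I"
      unfolding power_diff_sumr2 by (rule I'(5)[OF u])
    then show ?thesis by (auto simp: power_mult_distrib)
  qed
  have E_0: "E h g = 0" for h g
  \<comment> \<open>Continuity step: modulo each power of \<open>fps_X\<close>, \<open>g\<close> may
    be replaced by a polynomial truncation.\<close>
  proof (rule fps_eq_0_if_all_power_dvd)
    fix q
    obtain s where s: "\<And>i. mfps_X i ^ s i \<in> ideal_adjoin I f" using X_power by metis
    \<comment> \<open>The sum of the \<open>s i\<close> serves all variables at once; the factor
      \<open>q\<close> turns a multiple of \<open>f\<close> modulo \<open>I\<close> into a multiple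
      of \<open>f ^ q\<close>.\<close>
    define N where "N = (\<Sum>i\<in>UNIV. s i) * q"
    have X_N: "\<exists>u. mfps_X i ^ N - f ^ q * u \<in> I" for i
    proof -
      have "s i \<le> (\<Sum>i\<in>UNIV. s i)" by (rule member_le_sum) auto
      then obtain d where "(\<Sum>i\<in>UNIV. s i) = s i + d" by (auto simp: le_iff_add)
      then have "mfps_X i ^ N = (mfps_X i ^ s i * mfps_X i ^ d) ^ q"
        by (simp add: N_def power_mult power_add)
      then show ?thesis
        using power_adjoin[of "mfps_X i ^ s i * mfps_X i ^ d" q]
          ideal_class_ringD(5)[OF ideal_ideal_adjoin[OF I] s] by metis
    qed
    obtain p r where p: "finite {m. mfps_nth p m \<noteq> 0}" and g: "g = p + (\<Sum>i\<in>UNIV. mfps_X i ^ N * r i)"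
      by (rule mfps_split_X_powers)
    have dvd: "fps_X ^ q dvd E h (mfps_X i ^ N * r i)" for i
    proof -
      have "finite {m. mfps_nth (mfps_X i ^ N :: ('a, 'n) mfps) m \<noteq> 0}"
        unfolding mfps_X_power by (rule finite_subset[of _ "{Poly_Mapping.single i N}"]) auto
      \<comment> \<open>In the Leibniz rule the term \<open>E (h * r i) (mfps_X i ^ N)\<close>
        vanishes, its second argument being a polynomial. This moves the high power into the
        multiplier, where it is a multiple of \<open>f ^ q\<close> modulo \<open>I\<close>.\<close>
      then have "E h (mfps_X i ^ N * r i) = E (h * mfps_X i ^ N) (r i)"
        by (simp add: E_mult E_finite_support)
      moreover obtain u where "mfps_X i ^ N - f ^ q * u \<in> I" using X_N by blast
      then have "h * (mfps_X i ^ N - f ^ q * u) \<in> I" by (rule I'(3))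
      then have "E (h * (mfps_X i ^ N - f ^ q * u) + f ^ q * (h * u)) (r i) = fps_X ^ q * E (h * u) (r i)"
        unfolding E_add_left E_f_power by (simp add: E_in)
      moreover have "h * (mfps_X i ^ N - f ^ q * u) + f ^ q * (h * u) = h * mfps_X i ^ N"
        by (simp add: algebra_simps)
      ultimately show ?thesis by simp
    qed
    have "E h 0 = 0" by (rule E_finite_support) simp
    then have "E h (\<Sum>i\<in>A. k i) = (\<Sum>i\<in>A. E h (k i))" for k and A :: "'n set"
      by (induction A rule: infinite_finite_induct) (simp_all add: E_add)
    then have "E h g = (\<Sum>i\<in>UNIV. E h (mfps_X i ^ N * r i))"
      unfolding g E_add E_finite_support[OF p] by simp
    also have "fps_X ^ q dvd \<dots>" by (intro dvd_sum dvd)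
    finally show "fps_X ^ q dvd E h g" .
  qed
  \<comment> \<open>Evaluation at h = 1 and g = f: the partial derivatives lie in \<open>I\<close>,
    so only the trace of \<rho>(f)' remains.\<close>
  have "trace_form (1 * mfps_pderiv i f) (mfps_X i) = 0" for i
    using pderiv JI by (intro trace_form_in) auto
  then have "E 1 f = of_nat (card B)" by (simp add: E_def trace_form_one_t)
  then have "of_nat (card B) = (0 :: 'a fps)" by (simp add: E_0)
  \<comment> \<open>Comparing constant coefficients gives an equation in K, where characteristic
    zero applies.\<close>
  moreover have "fps_nth (of_nat (card B) :: 'a fps) 0 = of_nat (card B)"
    by (simp flip: fps_of_nat)
  ultimately have "of_nat (card B) = (0 :: 'a)" by (simp only: fps_zero_nth)
  then show False using card_B by simp
qed

theorem theorem1p2: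
  fixes f :: "('a::{alg_closed_field, field_char_0}, 'n::finite) mfps"
  assumes "mfps_nth f 0 = 0"
  shows "milnor_number f < \<infinity> \<longleftrightarrow> tjurina_number f < \<infinity>"
proof -
  define J where "J = Idl\<^bsub>class_ring\<^esub> (range (\<lambda>i. mfps_pderiv i f))"
  have J: "ideal J class_ring"
    unfolding J_def by (rule ring.genideal_ideal[OF class_ring.ring_axioms]) simp
  have pderiv: "mfps_pderiv i f \<in> J" for i
    unfolding J_def using ring.genideal_self[OF class_ring.ring_axioms, of "range (\<lambda>i. mfps_pderiv i f)"]
    by auto
  \<comment> \<open>\<open>vs_edim\<close> is finite exactly for finite-dimensional quotients, so
    only finite codimension matters from here on.\<close>
  have milnor: "milnor_number f < \<infinity> \<longleftrightarrow> finite_codim J"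
    using fin_dim_mfps_quot_iff[OF J] by (simp add: milnor_number_def vs_edim_def J_def)
  have tjurina: "tjurina_number f < \<infinity> \<longleftrightarrow> finite_codim (ideal_adjoin J f)"
    using fin_dim_mfps_quot_iff[OF ideal_ideal_adjoin[OF J]]
    by (simp add: tjurina_number_def vs_edim_def J_def genideal_insert_eq_adjoin)
  have "J \<subseteq> ideal_adjoin J f" by (auto simp: ideal_adjoin_def intro: exI[of _ 0])
  then have "finite_codim (ideal_adjoin J f)" if "finite_codim J"
    using that by (rule finite_codim_mono[rotated])
  moreover have "finite_codim J" if "finite_codim (ideal_adjoin J f)"
    using power_in_ideal_of_pderivs[OF J pderiv assms that] finite_codim_if_power_in[OF J that] by blast
  ultimately show ?thesis unfolding milnor tjurina by blast
qed

end
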